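(* Let $\sigma$ be an admissible weight on $\mathbb{D}$, let $\alpha>-1$, let $\Omega$ be a finite positive Borel measure on $\mathbb{D}$, let $0<p\le q<\infty$, and let $t>\frac{2q}{p(\alpha+2)}$. Then the following statements are equivalent: (a) $\Omega$ is a $(p,q,\sigma)$-Bergman Carleson measure. (b) The function $z\mapsto \dfrac{\widetilde{\Omega}_{t}(z)}{\sigma(z)^{q/p}(1-|z|^{2})^{\frac{2q}{p}-\frac{(\alpha+2)t}{2}}}$ is bounded on $\mathbb{D}$. (c) The function $z\mapsto \dfrac{\widehat{\Omega}_{R}(z)}{\sigma(z)^{q/p}(1-|z|^{2})^{\frac{2(q-p)}{p}}}$ is bounded on $\mathbb{D}$ for some (equivalently, for any) $R\in(0,1)$. (d) The sequence $\left\{\dfrac{\widehat{\Omega}_{r}(z_{k})}{\sigma(z_k)^{q/p}(1-|z_k|^{2})^{\frac{2(q-p)}{p}}}\right\}_{k=1}^{\infty}$ is bounded for some (equivalently, for any) $r$-lattice $\{z_k\}_{k=1}^{\infty}$ with $0<r<1$. Furthermore, $$\|i\|^{q}_{A_{\sigma}^{p}\to L^{q}(\Omega)}\asymp \sup_{z\in \mathbb{D}}\dfrac{\widetilde{\Omega}_{t}(z)}{\sigma(z)^{q/p}(1-|z|^{2})^{\frac{2q}{p}-\frac{(\alpha+2)t}{2}}}\asymp \sup_{z\in\mathbb{D}}\dfrac{\widehat{\Omega}_{R}(z)}{\sigma(z)^{q/p}(1-|z|^{2})^{\frac{2(q-p)}{p}}}\asymp \sup_{k}\dfrac{\widehat{\Omega}_{r}(z_{k})}{\sigma(z_k)^{q/p}(1-|z_k|^{2})^{\frac{2(q-p)}{p}}},$$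 where $i:A^p_\sigma\to L^q(\Omega)$ is the embedding $f\mapsto f$.
   Context: $\mathbb{D}=\{z\in\mathbb{C}:|z|<1\}$, $\mathcal{H}(\mathbb{D})$ is the space of analytic functions on $\mathbb{D}$, and $dA=\frac{dx\,dy}{\pi}$ is normalized area measure. A weight is a positive integrable function $\sigma\in C^2[0,1]$, extended to $\mathbb{D}$ by $\sigma(z)=\sigma(|z|)$. It is admissible if $\sigma$ is non-increasing on $[0,1)$ and $\sigma(r)(1-r)^{-(1+\delta)}$ is non-decreasing on $[0,1)$ for some $\delta>0$. For $0<p<\infty$, $A^p_\sigma=\{f\in\mathcal{H}(\mathbb{D}):\|f\|^p_{A^p_\sigma}=\int_{\mathbb{D}}|f|^p\sigma\,dA<\infty\}$, and $L^q(\Omega)$ is the space of measurable $f$ with $\|f\|_{L^q(\Omega)}^q=\int_{\mathbb{D}}|f|^q\,d\Omega<\infty$. A finite positive Borel measure $\Omega$ on $\mathbb{D}$ is a $(p,q,\sigma)$-Bergman Carleson measure if the embedding $i:A^p_\sigma\to L^q(\Omega)$ is bounded, i.e. there is a finite constant $C>0$ with $\int_{\mathbb{D}}|f|^q\,d\Omega\le C\|f\|^q_{A^p_\sigma}$ for all $f\in A^p_\sigma$; $\|i\|_{A^p_\sigma\to L^q(\Omega)}$ is the operator (quasi)norm. For $a\in\mathbb{D}$ and $r\in(0,1)$, $E(a,r)=\{z\in\mathbb{D}:|\frac{a-z}{1-\bar a z}|<r\}$ is the pseudohyperbolic disk and $|E(a,r)|$ is its area. A sequence $\{z_k\}_{k=1}^\infty\subset\mathbb{D}$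 is an $r$-lattice if the disks $E(z_k,r)$ cover $\mathbb{D}$ and there is an integer $M>0$ such that each $z\in\mathbb{D}$ belongs to at most $M$ of the disks $E(z_k,\frac{1+r}{2})$. For $\alpha>-1$, $K^\alpha(z,w)=(1-\bar w z)^{-(\alpha+2)}$ and $k^\alpha_z(w)=K^\alpha(z,w)/\sqrt{K^\alpha(z,z)}$. The $t$-Berezin transform of $\Omega$ is $\widetilde{\Omega}_t(z)=\int_{\mathbb{D}}|k^\alpha_z(w)|^t\,d\Omega(w)$, and the averaging function is $\widehat{\Omega}_r(z)=\Omega(E(z,r))/|E(z,r)|$. $X\asymp Y$ means that $X$ is bounded above and below by positive constant multiples of $Y$, with constants independent of the variables involved (here independent of $\Omega$). *)

theory Defs
  imports "HOL-Analysis.Analysis"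
begin

abbreviation unit_disk :: "complex set" (\<open>\<bbbD>\<close>) where
  "\<bbbD> \<equiv> ball 0 1"

definition disk_area :: "complex measure" where
  "disk_area = scale_measure (ennreal (1 / pi)) (restrict_space lborel \<bbbD>)"

definition disk_measures :: "complex measure set" where
  "disk_measures = {\<Omega>. sets \<Omega> = sets (restrict_space borel \<bbbD>) \<and> finite_measure \<Omega>}"

text \<open>Real powers on \<open>[0, \<infinity>]\<close>, only used with exponent \<open>a > 0\<close>.\<close>

definition epowr :: "ennreal \<Rightarrow> real \<Rightarrow> ennreal"  (infixr \<open>epowr\<close> 80) where
  "x epowr a = (if x = \<infinity> then \<infinity> else ennreal (enn2real x powr a))"

text \<open>One-sided derivatives are meant at the end points.\<close>

definition C2_unit_interval :: "(real \<Rightarrow> real) \<Rightarrow> bool" where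
  "C2_unit_interval \<sigma> \<longleftrightarrow> (\<exists>\<sigma>' \<sigma>''.
     (\<forall>x\<in>{0..1}. (\<sigma> has_real_derivative \<sigma>' x) (at x within {0..1})) \<and>
     (\<forall>x\<in>{0..1}. (\<sigma>' has_real_derivative \<sigma>'' x) (at x within {0..1})) \<and>
     continuous_on {0..1} \<sigma>'')"

text \<open>A weight is given by its radial profile \<open>\<sigma>\<close> on \<open>[0, 1]\<close>; on the disk its value at \<open>z\<close> is
  \<open>\<sigma> (cmod z)\<close>. Positivity includes the end point \<open>1\<close>. This matters: for \<open>\<sigma> r = (1 - r)\<^sup>2\<close> the
  condition \<open>t > 2 * q / (p * (\<alpha> + 2))\<close> would not be enough for the Berezin transform
  characterization of Carleson measures, as point masses show.\<close>

definition weight :: "(real \<Rightarrow> real) \<Rightarrow> bool" where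
  "weight \<sigma> \<longleftrightarrow> (\<forall>r\<in>{0..1}. \<sigma> r > 0) \<and> C2_unit_interval \<sigma> \<and>
     integrable disk_area (\<lambda>z. \<sigma> (cmod z))"

definition admissible :: "(real \<Rightarrow> real) \<Rightarrow> bool" where
  "admissible \<sigma> \<longleftrightarrow> antimono_on {0..<1} \<sigma> \<and>
     (\<exists>\<delta>>0. mono_on {0..<1} (\<lambda>r. \<sigma> r * (1 - r) powr (- (1 + \<delta>))))"

definition Lp_norm :: "real \<Rightarrow> complex measure \<Rightarrow> (complex \<Rightarrow> complex) \<Rightarrow> ennreal" where
  "Lp_norm q \<Omega> f = (\<integral>\<^sup>+z. ennreal (cmod (f z) powr q) \<partial>\<Omega>) epowr (1 / q)"

definition Bergman_norm :: "real \<Rightarrow> (real \<Rightarrow> real) \<Rightarrow> (complex \<Rightarrow> complex) \<Rightarrow> ennreal" where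
  "Bergman_norm p \<sigma> f =
     (\<integral>\<^sup>+z. ennreal (cmod (f z) powr p * \<sigma> (cmod z)) \<partial>disk_area) epowr (1 / p)"

definition Bergman_space :: "real \<Rightarrow> (real \<Rightarrow> real) \<Rightarrow> (complex \<Rightarrow> complex) set" where
  "Bergman_space p \<sigma> = {f. f holomorphic_on \<bbbD> \<and> Bergman_norm p \<sigma> f < \<infinity>}"

definition Bergman_Carleson ::
  "real \<Rightarrow> real \<Rightarrow> (real \<Rightarrow> real) \<Rightarrow> complex measure \<Rightarrow> bool" where
  "Bergman_Carleson p q \<sigma> \<Omega> \<longleftrightarrow> (\<exists>C::real. C > 0 \<and> (\<forall>f\<in>Bergman_space p \<sigma>.
     (\<integral>\<^sup>+z. ennreal (cmod (f z) powr q) \<partial>\<Omega>) \<le> ennreal C * Bergman_norm p \<sigma> f epowr q))"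

text \<open>The operator (quasi)norm of the embedding, with value \<open>\<infinity>\<close> if the embedding is unbounded.\<close>

definition embedding_norm ::
  "real \<Rightarrow> real \<Rightarrow> (real \<Rightarrow> real) \<Rightarrow> complex measure \<Rightarrow> ennreal" where
  "embedding_norm p q \<sigma> \<Omega> =
     (SUP f\<in>{f \<in> Bergman_space p \<sigma>. Bergman_norm p \<sigma> f \<le> 1}. Lp_norm q \<Omega> f)"

definition pseudohyperbolic_disk :: "complex \<Rightarrow> real \<Rightarrow> complex set" where
  "pseudohyperbolic_disk a r = {z\<in>\<bbbD>. cmod ((a - z) / (1 - cnj a * z)) < r}"

definition r_lattice :: "real \<Rightarrow> (nat \<Rightarrow> complex) \<Rightarrow> bool" where
  "r_lattice r z \<longleftrightarrow> range z \<subseteq> \<bbbD> \<and>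
     \<bbbD> = (\<Union>k. pseudohyperbolic_disk (z k) r) \<and>
     (\<exists>M::nat. M > 0 \<and> (\<forall>w\<in>\<bbbD>.
        finite {k. w \<in> pseudohyperbolic_disk (z k) ((1 + r) / 2)} \<and>
        card {k. w \<in> pseudohyperbolic_disk (z k) ((1 + r) / 2)} \<le> M))"

definition Bergman_kernel :: "real \<Rightarrow> complex \<Rightarrow> complex \<Rightarrow> complex" where
  "Bergman_kernel \<alpha> z w = (1 - cnj w * z) powr complex_of_real (- (\<alpha> + 2))"

definition normalized_kernel :: "real \<Rightarrow> complex \<Rightarrow> complex \<Rightarrow> complex" where
  "normalized_kernel \<alpha> z w = Bergman_kernel \<alpha> z w / csqrt (Bergman_kernel \<alpha> z z)"

definition Berezin :: "real \<Rightarrow> real \<Rightarrow> complex measure \<Rightarrow> complex \<Rightarrow> real" where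
  "Berezin \<alpha> t \<Omega> z = (\<integral>w. cmod (normalized_kernel \<alpha> z w) powr t \<partial>\<Omega>)"

definition averaging :: "real \<Rightarrow> complex measure \<Rightarrow> complex \<Rightarrow> real" where
  "averaging r \<Omega> z =
     measure \<Omega> (pseudohyperbolic_disk z r) / measure disk_area (pseudohyperbolic_disk z r)"

definition Berezin_quotient ::
  "real \<Rightarrow> real \<Rightarrow> (real \<Rightarrow> real) \<Rightarrow> real \<Rightarrow> real \<Rightarrow> complex measure \<Rightarrow> complex \<Rightarrow> real" where
  "Berezin_quotient p q \<sigma> \<alpha> t \<Omega> z = Berezin \<alpha> t \<Omega> z /
     (\<sigma> (cmod z) powr (q / p) * (1 - (cmod z)\<^sup>2) powr (2 * q / p - (\<alpha> + 2) * t / 2))"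

definition averaging_quotient ::
  "real \<Rightarrow> real \<Rightarrow> (real \<Rightarrow> real) \<Rightarrow> real \<Rightarrow> complex measure \<Rightarrow> complex \<Rightarrow> real" where
  "averaging_quotient p q \<sigma> r \<Omega> z = averaging r \<Omega> z /
     (\<sigma> (cmod z) powr (q / p) * (1 - (cmod z)\<^sup>2) powr (2 * (q - p) / p))"

text \<open>Comparability of two \<open>[0, \<infinity>]\<close>-valued quantities with constants uniform over \<open>S\<close>.\<close>

definition comparable_on :: "'a set \<Rightarrow> ('a \<Rightarrow> ennreal) \<Rightarrow> ('a \<Rightarrow> ennreal) \<Rightarrow> bool" where
  "comparable_on S F G \<longleftrightarrow> (\<exists>c C::real. c > 0 \<and> C > 0 \<and>
     (\<forall>x\<in>S. ennreal c * G x \<le> F x \<and> F x \<le> ennreal C * G x))"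

end

theory Submission
  imports Defs "HOL-Complex_Analysis.Cauchy_Integral_Formula"
begin

text \<open>
  The weight \<open>\<sigma>\<close> is continuous and positive on the compact interval \<open>[0, 1]\<close>, so it lies between
  two positive constants. Up to constants all norms and quotients are those of the constant weight,
  and the theorem becomes a statement about unweighted Bergman spaces. Put \<open>d(z) = 1 - |z|\<^sup>2\<close>,
  \<open>\<beta> = 2 q / p\<close> and \<open>s = (\<alpha> + 2) t\<close>, so that \<open>s > \<beta>\<close>. Up to constants the averaging quotient at \<open>z\<close> is
  \<open>\<Omega>(E(z, R)) / d(z) powr \<beta>\<close>, because \<open>E(z, R)\<close> has area comparable to \<open>d(z)\<^sup>2\<close>, and the Berezin
  quotient is \<open>d(z) powr (s - \<beta>)\<close> times the \<open>\<Omega>\<close>-integral of \<open>|1 - cnj z w| powr (-s)\<close>.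

  Everything follows from a circle of inequalities with constants that do not depend on \<open>\<Omega>\<close>:
  lattice averages \<open>\<le>\<close> averages \<open>\<lesssim>\<close> Berezin quotient \<open>\<lesssim>\<close> \<open>q\<close>-th power of the embedding norm
  \<open>\<lesssim>\<close> lattice averages. The radii at the two ends of the circle are independent of each other,
  which is why the choice of radius and lattice does not matter.

  \<^item> On \<open>E(z, R)\<close> the kernel \<open>|1 - cnj z w|\<close> is comparable to \<open>d(z)\<close>, so restricting the Berezin integral
    to this disk bounds the average (\<open>averaging_quotient_le_Berezin_quotient\<close>).

  \<^item> The function \<open>A (1 - cnj z w) powr (-s / q)\<close> has as \<open>L\<^sup>q(\<Omega>)\<close> norm to the power \<open>q\<close> a multiple of the
    Berezin quotient. The Forelli-Rudin estimate, applicable since \<open>s p / q > 2\<close>, shows that \<open>A\<close> can be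
    of size \<open>d(z) powr ((s - \<beta>) / q)\<close> for a function in the unit ball (\<open>Bergman_test_function\<close>).

  \<^item> Let \<open>{z\<^sub>k}\<close> be a lattice. The mean value inequality for \<open>|f| powr p\<close> bounds \<open>|f| powr p\<close>, up to constants, on
    \<open>E(z\<^sub>k, r)\<close> by \<open>d(z\<^sub>k) powr (-2)\<close> times its integral \<open>J\<^sub>k\<close> over the larger disk \<open>E(z\<^sub>k, (1 + r) / 2)\<close>. Hence
    the integral of \<open>|f| powr q\<close> over \<open>E(z\<^sub>k, r)\<close> is at most a constant times
    \<open>\<Omega>(E(z\<^sub>k, r)) d(z\<^sub>k) powr (-\<beta>) J\<^sub>k powr (q / p)\<close>. Since \<open>q \<ge> p\<close>, all but one power of \<open>J\<^sub>k\<close> can be bounded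
    by the full integral, and the remaining sum of the \<open>J\<^sub>k\<close> is controlled by bounded overlap
    (\<open>Carleson_bound_if_averaging_quotient_bounded_on_lattice\<close>).

  Lattices of every radius exist (\<open>ex_r_lattice\<close>): a maximal separated set covers the disk, and comparing
  areas bounds its overlap.
\<close>

section \<open>Powers and domination in the extended half-line\<close>

lemma epowr_simps [simp]:
  "0 \<le> x \<Longrightarrow> ennreal x epowr a = ennreal (x powr a)" "top epowr a = top"
  by (auto simp: epowr_def)

lemma epowr_less_top_iff [simp]: "x epowr a < top \<longleftrightarrow> x < top"
  by (cases x) (auto simp: epowr_def)

lemma epowr_mono: "x \<le> y \<Longrightarrow> a \<ge> 0 \<Longrightarrow> x epowr a \<le> y epowr a"
  by (cases x; cases y) (auto simp: top_unique powr_mono2 ennreal_leI)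

text \<open>Passes between the \<open>q\<close>-th power of an operator norm and a bound on integrals of \<open>q\<close>-th powers. It
  also holds at \<open>\<infinity>\<close>, so unbounded embeddings need no separate treatment.\<close>

lemma epowr_epowr_inverse: "a > 0 \<Longrightarrow> (x epowr (1 / a)) epowr a = x"
  by (cases x) (auto simp: powr_powr)

lemma ennreal_mult3:
  "0 \<le> a \<Longrightarrow> 0 \<le> b \<Longrightarrow> 0 \<le> c \<Longrightarrow> ennreal (a * (b * c)) = ennreal a * (ennreal b * ennreal c)"
  by (simp add: ennreal_mult)

text \<open>One half of \<^const>\<open>comparable_on\<close>. Unlike comparability it is proved around a circle of
  inequalities, each step in one direction only.\<close>

definition dominated_on :: "'a set \<Rightarrow> ('a \<Rightarrow> ennreal) \<Rightarrow> ('a \<Rightarrow> ennreal) \<Rightarrow> bool" where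
  "dominated_on S F G \<longleftrightarrow> (\<exists>C::real. C > 0 \<and> (\<forall>x\<in>S. F x \<le> ennreal C * G x))"

lemma dominated_on_trans [trans]:
  assumes "dominated_on S F G" "dominated_on S G H"
  shows "dominated_on S F H"
proof -
  obtain C D where C: "C > 0" "\<And>x. x \<in> S \<Longrightarrow> F x \<le> ennreal C * G x"
    and D: "D > 0" "\<And>x. x \<in> S \<Longrightarrow> G x \<le> ennreal D * H x"
    using assms unfolding dominated_on_def by blast
  have "F x \<le> ennreal (C * D) * H x" if "x \<in> S" for x
    using order_trans[OF C(2)[OF that] mult_left_mono[OF D(2)[OF that]]] C(1) D(1)
    by (simp add: ennreal_mult mult.assoc)
  then show ?thesis unfolding dominated_on_def using C(1) D(1) by (intro exI[of _ "C * D"]) auto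
qed

lemma dominated_on_less_top:
  "dominated_on S F G \<Longrightarrow> x \<in> S \<Longrightarrow> G x < top \<Longrightarrow> F x < top"
  unfolding dominated_on_def by (auto simp: ennreal_mult_less_top intro: le_less_trans)

lemma comparable_on_if_dominated_on:
  assumes "dominated_on S F G" "dominated_on S G F"
  shows "comparable_on S F G"
proof -
  obtain C D where C: "C > 0" "\<And>x. x \<in> S \<Longrightarrow> F x \<le> ennreal C * G x"
    and D: "D > 0" "\<And>x. x \<in> S \<Longrightarrow> G x \<le> ennreal D * F x"
    using assms unfolding dominated_on_def by blast
  have "ennreal (1 / D) * G x \<le> F x" if "x \<in> S" for x
    using mult_left_mono[OF D(2)[OF that], of "ennreal (1 / D)"] D(1)
    by (simp add: mult.assoc[symmetric] ennreal_mult[symmetric])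
  then show ?thesis
    unfolding comparable_on_def using C D(1) by (intro exI[of _ "1 / D"] exI[of _ C]) auto
qed

text \<open>Translates the qualitative conditions into finiteness of the suprema, which is what domination
  transports.\<close>

lemma bounded_image_iff_SUP_less_top:
  assumes "\<And>x. x \<in> S \<Longrightarrow> 0 \<le> (F x :: real)"
  shows "bounded (F ` S) \<longleftrightarrow> (SUP x\<in>S. ennreal (F x)) < top"
proof
  assume "bounded (F ` S)"
  then obtain b where b: "\<forall>y\<in>F ` S. norm y \<le> b" unfolding bounded_iff by blast
  have "F x \<le> b" if "x \<in> S" for x
    using b that abs_le_D1[of "F x" b] by simp
  then have "(SUP x\<in>S. ennreal (F x)) \<le> ennreal b" by (intro SUP_least ennreal_leI)
  then show "(SUP x\<in>S. ennreal (F x)) < top" by (rule le_less_trans) simp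
next
  assume fin: "(SUP x\<in>S. ennreal (F x)) < top"
  have "norm (F x) \<le> enn2real (SUP x\<in>S. ennreal (F x))" if "x \<in> S" for x
  proof -
    have "ennreal (F x) \<le> ennreal (enn2real (SUP x\<in>S. ennreal (F x)))"
      using fin SUP_upper[OF that, of "\<lambda>x. ennreal (F x)"] by simp
    then show ?thesis using assms[OF that] by (subst (asm) ennreal_le_iff) auto
  qed
  then show "bounded (F ` S)" unfolding bounded_iff by blast
qed

section \<open>Pseudohyperbolic disks\<close>

lemma mem_pseudohyperbolic_disk:
  assumes "cmod a < 1"
  shows "z \<in> pseudohyperbolic_disk a r \<longleftrightarrow>
    cmod z < 1 \<and> cmod (a - z) < r * cmod (1 - cnj a * z)"
proof (cases "cmod z < 1")
  case True
  then have "cmod (cnj a * z) < 1"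
    using assms mult_strict_mono'[of "cmod a" 1 "cmod z" 1] by (simp add: norm_mult)
  then have "cmod (1 - cnj a * z) > 0"
    by auto
  then show ?thesis
    using True by (simp add: pseudohyperbolic_disk_def norm_divide divide_less_eq)
qed (simp add: pseudohyperbolic_disk_def)

text \<open>Both \<open>1 - |a|\<close> and \<open>1 - |z|\<close> are at most \<open>1 - |a| |z| \<le> |1 - cnj a z|\<close>, and
  \<open>1 - x\<^sup>2 = (1 - x) (1 + x)\<close>.\<close>

lemma norm_one_minus_cnj_mult_ge:
  assumes "cmod a < 1" "cmod z < 1"
  shows "1 - (cmod a)\<^sup>2 \<le> 2 * cmod (1 - cnj a * z)"
    and "1 - (cmod z)\<^sup>2 \<le> 2 * cmod (1 - cnj a * z)"
    and "cmod (1 - cnj a * z) > 0"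
proof -
  have *: "1 - cmod a * cmod z \<le> cmod (1 - cnj a * z)"
    using norm_triangle_ineq2[of 1 "cnj a * z"] by (simp add: norm_mult)
  have "cmod a * cmod z \<le> cmod a" "cmod a * cmod z \<le> cmod z"
    using assms by (auto simp: mult_left_le mult_left_le_one_le)
  moreover have "1 - x\<^sup>2 \<le> 2 * (1 - x)" for x :: real
    using zero_le_power2[of "1 - x"] by (simp add: power2_eq_square algebra_simps)
  ultimately show "1 - (cmod a)\<^sup>2 \<le> 2 * cmod (1 - cnj a * z)"
    "1 - (cmod z)\<^sup>2 \<le> 2 * cmod (1 - cnj a * z)"
    "cmod (1 - cnj a * z) > 0"
    using * assms by (smt (verit))+
qed

text \<open>This identity carries all the hyperbolic geometry needed below: for points at pseudohyperbolic
  distance less than \<open>r\<close> it bounds \<open>|1 - cnj a z|\<^sup>2\<close> by a constant times the product of the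
  defects \<open>1 - |a|\<^sup>2\<close> and \<open>1 - |z|\<^sup>2\<close>.\<close>

lemma norm_one_minus_cnj_mult_squared:
  "(cmod (1 - cnj a * z))\<^sup>2 = (cmod (a - z))\<^sup>2 + (1 - (cmod a)\<^sup>2) * (1 - (cmod z)\<^sup>2)"
  unfolding cmod_power2 by (simp add: power2_eq_square algebra_simps)

lemma norm_one_minus_cnj_mult_commute: "cmod (1 - cnj a * z) = cmod (1 - cnj z * a)"
proof -
  have "1 - cnj z * a = cnj (1 - cnj a * z)" by simp
  then show ?thesis by (metis complex_mod_cnj)
qed

lemma defect_pos: "cmod z < 1 \<Longrightarrow> 1 - (cmod z)\<^sup>2 > 0"
  by (simp add: power_less_one_iff abs_square_less_1)

text \<open>The pseudohyperbolic condition turns the identity above into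
  \<open>(1 - r\<^sup>2) |1 - cnj a z|\<^sup>2 \<le> (1 - |a|\<^sup>2) (1 - |z|\<^sup>2)\<close>; one factor on the right is at most
  \<open>2 |1 - cnj a z|\<close> and cancels. Together with \<open>norm_one_minus_cnj_mult_ge\<close> this makes
  \<open>1 - |a|\<^sup>2\<close>, \<open>1 - |z|\<^sup>2\<close> and \<open>|1 - cnj a z|\<close> comparable on \<open>E(a, r)\<close>.\<close>

lemma defect_comparable:
  assumes "cmod a < 1" "z \<in> pseudohyperbolic_disk a r" "0 < r" "r < 1"
  shows "(1 - r\<^sup>2) / 2 * cmod (1 - cnj a * z) \<le> 1 - (cmod a)\<^sup>2"
    and "(1 - r\<^sup>2) / 2 * cmod (1 - cnj a * z) \<le> 1 - (cmod z)\<^sup>2"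
proof -
  let ?d = "cmod (1 - cnj a * z)"
  have z: "cmod z < 1" "cmod (a - z) \<le> r * ?d"
    using assms mem_pseudohyperbolic_disk by auto
  have "(cmod (a - z))\<^sup>2 \<le> (r * ?d)\<^sup>2"
    using z by (intro power_mono) auto
  then have *: "(1 - r\<^sup>2) * ?d\<^sup>2 \<le> (1 - (cmod a)\<^sup>2) * (1 - (cmod z)\<^sup>2)"
    using norm_one_minus_cnj_mult_squared[of a z] by (simp add: power_mult_distrib algebra_simps)
  note g = norm_one_minus_cnj_mult_ge[OF assms(1) z(1)]
  have pos: "1 - (cmod a)\<^sup>2 > 0" "1 - (cmod z)\<^sup>2 > 0"
    using defect_pos assms(1) z(1) by auto
  have "(1 - (cmod a)\<^sup>2) * (1 - (cmod z)\<^sup>2) \<le> (1 - (cmod a)\<^sup>2) * (2 * ?d)"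
    using g pos by (intro mult_left_mono) auto
  with * have "((1 - r\<^sup>2) / 2 * ?d) * ?d \<le> (1 - (cmod a)\<^sup>2) * ?d"
    by (simp add: power2_eq_square)
  then show "(1 - r\<^sup>2) / 2 * ?d \<le> 1 - (cmod a)\<^sup>2"
    using g(3) mult_le_cancel_right_pos by blast
  have "(1 - (cmod a)\<^sup>2) * (1 - (cmod z)\<^sup>2) \<le> (2 * ?d) * (1 - (cmod z)\<^sup>2)"
    using g pos by (intro mult_right_mono) auto
  with * have "((1 - r\<^sup>2) / 2 * ?d) * ?d \<le> (1 - (cmod z)\<^sup>2) * ?d"
    by (simp add: power2_eq_square ac_simps)
  then show "(1 - r\<^sup>2) / 2 * ?d \<le> 1 - (cmod z)\<^sup>2"
    using g(3) mult_le_cancel_right_pos by blast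
qed

lemma pseudohyperbolic_disk_subset_ball:
  assumes "cmod a < 1" "0 < r" "r < 1"
  shows "pseudohyperbolic_disk a r \<subseteq> ball a (2 / (1 - r\<^sup>2) * (1 - (cmod a)\<^sup>2))"
proof
  fix z assume z: "z \<in> pseudohyperbolic_disk a r"
  have r: "1 - r\<^sup>2 > 0" using assms by (simp add: power_less_one_iff)
  have "cmod z < 1" and l: "cmod (a - z) < r * cmod (1 - cnj a * z)"
    using z assms mem_pseudohyperbolic_disk by auto
  have "cmod (a - z) < 1 * cmod (1 - cnj a * z)"
    using l mult_right_mono[of r 1 "cmod (1 - cnj a * z)"] assms by simp
  also have "\<dots> \<le> 2 / (1 - r\<^sup>2) * (1 - (cmod a)\<^sup>2)"
    using defect_comparable(1)[OF assms(1) z assms(2,3)] r by (simp add: field_simps)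
  finally show "z \<in> ball a (2 / (1 - r\<^sup>2) * (1 - (cmod a)\<^sup>2))"
    by (simp add: dist_norm)
qed

text \<open>Around every point of \<open>E(a, r)\<close> there is room for a Euclidean disk of radius comparable to the
  distance to the circle inside the larger disk \<open>E(a, (1 + r) / 2)\<close>. The radius is at most
  \<open>(1 - r) / 4\<close> times \<open>|1 - cnj a w|\<close>; a shift by this amount changes numerator and denominator of the
  pseudohyperbolic distance little enough. No triangle inequality for that distance is involved.\<close>

lemma ball_subset_pseudohyperbolic_disk:
  assumes "cmod a < 1" "cmod w < 1" "cmod (a - w) \<le> r * cmod (1 - cnj a * w)" "0 \<le> r" "r < 1"
    and z: "cmod (w - z) < (1 - r) / 8 * (1 - (cmod w)\<^sup>2)"
  shows "z \<in> pseudohyperbolic_disk a ((1 + r) / 2)"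
proof -
  let ?e = "(1 - r) / 8 * (1 - (cmod w)\<^sup>2)" and ?d = "cmod (1 - cnj a * w)"
  have g: "1 - (cmod w)\<^sup>2 \<le> 2 * ?d" "?d > 0"
    using norm_one_minus_cnj_mult_ge[OF assms(1,2)] by auto
  have w: "1 - (cmod w)\<^sup>2 \<le> 2 * (1 - cmod w)"
    using zero_le_power2[of "1 - cmod w"] by (simp add: power2_eq_square algebra_simps)
  have "?e \<le> 1 / 8 * (1 - (cmod w)\<^sup>2)"
    using assms defect_pos[OF assms(2)] by (intro mult_right_mono) auto
  also have "\<dots> \<le> (1 - cmod w) / 4"
    using w by simp
  finally have "?e \<le> (1 - cmod w) / 4" .
  then have "cmod (z - w) < (1 - cmod w) / 4"
    using z norm_minus_commute[of z w] by simp
  then have "cmod z < 1"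
    using norm_triangle_sub[of z w] assms(2) by simp
  have e: "?e \<le> (1 - r) / 4 * ?d"
    using mult_left_mono[OF g(1), of "(1 - r) / 8"] assms by (simp add: field_simps)
  have "cmod (a - z) \<le> cmod (a - w) + cmod (w - z)"
    using norm_triangle_ineq[of "a - w" "w - z"] by simp
  also have "\<dots> < r * ?d + ?e" using assms by linarith
  finally have 1: "cmod (a - z) < (1 + 3 * r) / 4 * ?d"
    using e by (simp add: field_simps)
  have "cmod (cnj a * (z - w)) \<le> cmod (w - z)"
    using assms(1) by (simp add: norm_mult norm_minus_commute mult_left_le_one_le)
  then have "?d - ?e \<le> cmod (1 - cnj a * z)"
    using norm_triangle_ineq2[of "1 - cnj a * w" "cnj a * (z - w)"] z
    by (simp add: right_diff_distrib)
  moreover have "(3 + r) / 4 * ?d = ?d - (1 - r) / 4 * ?d"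
    by (simp add: field_simps)
  ultimately have "(3 + r) / 4 * ?d \<le> cmod (1 - cnj a * z)"
    using e by linarith
  then have "(1 + r) / 2 * ((3 + r) / 4 * ?d) \<le> (1 + r) / 2 * cmod (1 - cnj a * z)"
    using assms by (intro mult_left_mono) auto
  moreover have "(1 + 3 * r) / 4 * ?d \<le> (1 + r) / 2 * ((3 + r) / 4 * ?d)"
  proof -
    have "(1 + r) / 2 * ((3 + r) / 4 * ?d) - (1 + 3 * r) / 4 * ?d = (1 - r)\<^sup>2 / 8 * ?d"
      by (simp add: power2_eq_square field_simps)
    moreover have "0 \<le> (1 - r)\<^sup>2 / 8 * ?d" using g by auto
    ultimately show ?thesis by linarith
  qed
  ultimately have "cmod (a - z) < (1 + r) / 2 * cmod (1 - cnj a * z)"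
    using 1 by linarith
  then show ?thesis
    using \<open>cmod z < 1\<close> assms(1) mem_pseudohyperbolic_disk by auto
qed

lemma ball_subset_pseudohyperbolic_disk_center:
  assumes "cmod a < 1" "0 < r" "r < 1"
  shows "ball a (r / 4 * (1 - (cmod a)\<^sup>2)) \<subseteq> pseudohyperbolic_disk a r"
proof
  fix z assume "z \<in> ball a (r / 4 * (1 - (cmod a)\<^sup>2))"
  then have z: "cmod (a - z) < r / 4 * (1 - (cmod a)\<^sup>2)"
    by (simp add: dist_norm)
  have a: "0 < 1 - (cmod a)\<^sup>2" "1 - (cmod a)\<^sup>2 \<le> 2 * (1 - cmod a)"
    using defect_pos[OF assms(1)] zero_le_power2[of "1 - cmod a"]
    by (simp_all add: power2_eq_square algebra_simps)
  have "r / 4 * (1 - (cmod a)\<^sup>2) \<le> 1 / 4 * (1 - (cmod a)\<^sup>2)"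
    using a assms by (intro mult_right_mono) auto
  with z have z': "cmod (a - z) < 1 / 4 * (1 - (cmod a)\<^sup>2)"
    by linarith
  then have "cmod (a - z) < 1 - cmod a"
    using a(2) assms(1) by argo
  then have "cmod z < 1"
    using norm_triangle_sub[of z a] norm_minus_commute[of z a] by linarith
  have "1 - cnj a * z = of_real (1 - (cmod a)\<^sup>2) - cnj a * (z - a)"
    by (simp add: complex_norm_square ring_distribs mult.commute del: of_real_power)
  moreover have "cmod (of_real (1 - (cmod a)\<^sup>2)) = 1 - (cmod a)\<^sup>2"
    using a(1) by (simp only: norm_of_real)
  ultimately have "1 - (cmod a)\<^sup>2 - cmod (cnj a * (z - a)) \<le> cmod (1 - cnj a * z)"
    using norm_triangle_ineq2[of "of_real (1 - (cmod a)\<^sup>2)" "cnj a * (z - a)"] by metis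
  moreover have "cmod (cnj a * (z - a)) \<le> cmod (a - z)"
    using assms(1) by (simp add: norm_mult norm_minus_commute mult_left_le_one_le)
  ultimately have "3 / 4 * (1 - (cmod a)\<^sup>2) \<le> cmod (1 - cnj a * z)"
    using z' by argo
  then have "r * (3 / 4 * (1 - (cmod a)\<^sup>2)) \<le> r * cmod (1 - cnj a * z)"
    using assms by (intro mult_left_mono) auto
  moreover have "r / 4 * (1 - (cmod a)\<^sup>2) \<le> r * (3 / 4 * (1 - (cmod a)\<^sup>2))"
    using a assms by (simp add: field_simps)
  ultimately show "z \<in> pseudohyperbolic_disk a r"
    using z \<open>cmod z < 1\<close> assms(1) mem_pseudohyperbolic_disk by auto
qed

lemma open_pseudohyperbolic_disk:
  assumes "cmod a < 1"
  shows "open (pseudohyperbolic_disk a r)"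
proof -
  have "pseudohyperbolic_disk a r = \<bbbD> \<inter> {z. cmod (a - z) < r * cmod (1 - cnj a * z)}"
    using mem_pseudohyperbolic_disk[OF assms] by auto
  then show ?thesis
    by (auto intro!: open_Int open_Collect_less continuous_intros)
qed

section \<open>Normalized area\<close>

text \<open>Lets the estimates be carried out with Lebesgue measure on the plane.\<close>

lemma nn_integral_disk_area:
  assumes "f \<in> borel_measurable (restrict_space borel \<bbbD>)"
  shows "(\<integral>\<^sup>+z. f z \<partial>disk_area) = ennreal (1 / pi) * (\<integral>\<^sup>+z. f z * indicator \<bbbD> z \<partial>lborel)"
proof -
  have "f \<in> borel_measurable (restrict_space lborel \<bbbD>)"
    using assms by (simp cong: measurable_cong_sets sets_restrict_space_cong)
  then show ?thesis
    by (simp add: disk_area_def nn_integral_scale_measure nn_integral_restrict_space)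
qed

lemma emeasure_disk_area:
  assumes "A \<in> sets borel" "A \<subseteq> \<bbbD>"
  shows "emeasure disk_area A = ennreal (1 / pi) * emeasure lborel A"
  using assms by (simp add: disk_area_def emeasure_restrict_space)

lemma emeasure_lborel_ball_complex:
  "r \<ge> 0 \<Longrightarrow> emeasure lborel (ball (c :: complex) r) = ennreal (pi * r\<^sup>2)"
  by (simp add: emeasure_ball eval_unit_ball_vol)

text \<open>A pseudohyperbolic disk contains and is contained in Euclidean disks around its centre of radius
  comparable to \<open>1 - |a|\<^sup>2\<close>.\<close>

lemma measure_pseudohyperbolic_disk:
  assumes "cmod a < 1" "0 < r" "r < 1"
  shows "(r / 4)\<^sup>2 * (1 - (cmod a)\<^sup>2)\<^sup>2 \<le> measure disk_area (pseudohyperbolic_disk a r)"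
    and "measure disk_area (pseudohyperbolic_disk a r)
           \<le> (2 / (1 - r\<^sup>2))\<^sup>2 * (1 - (cmod a)\<^sup>2)\<^sup>2"
proof -
  let ?E = "pseudohyperbolic_disk a r" and ?d = "1 - (cmod a)\<^sup>2"
  have r: "1 - r\<^sup>2 > 0" and d: "?d > 0"
    using assms by (auto simp: power_less_one_iff defect_pos)
  have E: "?E \<in> sets borel" "?E \<subseteq> \<bbbD>"
    using open_pseudohyperbolic_disk[OF assms(1)] by (auto simp: pseudohyperbolic_disk_def)
  have eq: "ennreal (1 / pi) * ennreal (pi * x\<^sup>2) = ennreal (x\<^sup>2)" for x
    by (simp add: ennreal_mult' [symmetric])
  have "emeasure lborel (ball a (r / 4 * ?d)) \<le> emeasure lborel ?E"
    using ball_subset_pseudohyperbolic_disk_center[OF assms] E by (intro emeasure_mono) auto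
  then have "ennreal (1 / pi) * ennreal (pi * (r / 4 * ?d)\<^sup>2) \<le> emeasure disk_area ?E"
    using d assms E by (simp add: emeasure_disk_area emeasure_lborel_ball_complex mult_left_mono
        del: divide_ennreal)
  then have 1: "ennreal ((r / 4)\<^sup>2 * ?d\<^sup>2) \<le> emeasure disk_area ?E"
    unfolding eq unfolding power_mult_distrib .
  have "emeasure lborel ?E \<le> emeasure lborel (ball a (2 / (1 - r\<^sup>2) * ?d))"
    using pseudohyperbolic_disk_subset_ball[OF assms] by (intro emeasure_mono) auto
  then have "emeasure disk_area ?E \<le> ennreal (1 / pi) * ennreal (pi * (2 / (1 - r\<^sup>2) * ?d)\<^sup>2)"
    using d r E by (simp add: emeasure_disk_area emeasure_lborel_ball_complex mult_left_mono
        del: divide_ennreal)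
  then have 2: "emeasure disk_area ?E \<le> ennreal ((2 / (1 - r\<^sup>2))\<^sup>2 * ?d\<^sup>2)"
    unfolding eq unfolding power_mult_distrib .
  then have "emeasure disk_area ?E < \<infinity>"
    by (rule order.strict_trans1) simp
  then have *: "emeasure disk_area ?E = ennreal (measure disk_area ?E)"
    by (simp add: emeasure_eq_ennreal_measure)
  show "(r / 4)\<^sup>2 * ?d\<^sup>2 \<le> measure disk_area ?E" "measure disk_area ?E \<le> (2 / (1 - r\<^sup>2))\<^sup>2 * ?d\<^sup>2"
    using 1 2 unfolding * by (simp_all add: ennreal_le_iff)
qed

section \<open>Mean value inequality for powers of holomorphic functions\<close>

text \<open>Cauchy's integral formula. The point \<open>w\<close> may be off centre, at distance at least \<open>r / 2\<close> from the
  circle, which costs the factor \<open>2\<close>.\<close>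

lemma norm_le_circle_mean:
  assumes f: "f holomorphic_on S" and S: "cball c r \<subseteq> S" and "open S"
    and w: "cmod (w - c) \<le> r / 2" and r: "r > 0"
  shows "ennreal (cmod (f w)) \<le>
    2 * (\<integral>\<^sup>+x. ennreal (cmod (f (circlepath c r x))) * indicator {0..1} x \<partial>lborel)"
proof -
  have fc: "continuous_on (cball c r) f"
    using f S holomorphic_on_imp_continuous_on holomorphic_on_subset by blast
  have "((\<lambda>u. f u / (u - w)) has_contour_integral (2 * of_real pi * \<i> * f w)) (circlepath c r)"
    using f S w r by (intro Cauchy_integral_circlepath fc)
      (auto intro: holomorphic_on_subset[OF f order_trans[OF ball_subset_cball S]] simp: field_simps)
  then have 1: "((\<lambda>x. f (circlepath c r x) / (circlepath c r x - w) *
      (2 * pi * \<i> * r * exp (2 * of_real pi * \<i> * x))) has_integral (2 * of_real pi * \<i> * f w)) {0..1}"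
    by (simp add: has_contour_integral vector_derivative_circlepath)
  have cont: "continuous_on {0..1} (\<lambda>x. f (circlepath c r x))"
    using r by (intro continuous_on_compose2[OF fc]
        valid_path_imp_path[OF valid_path_circlepath, unfolded path_def])
      (auto simp: circlepath dist_norm norm_mult)
  have int: "(\<lambda>x. 4 * pi * cmod (f (circlepath c r x))) integrable_on {0..1}"
    by (intro integrable_continuous_real continuous_intros cont)
  have bd: "cmod (f (circlepath c r x) / (circlepath c r x - w) *
      (2 * pi * \<i> * r * exp (2 * of_real pi * \<i> * x))) \<le> 4 * pi * cmod (f (circlepath c r x))" for x
  proof -
    have "cmod (circlepath c r x - c) = r"
      using r by (simp add: circlepath norm_mult)
    then have d: "r / 2 \<le> cmod (circlepath c r x - w)"
      using w norm_triangle_ineq[of "circlepath c r x - w" "w - c"] by simp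
    have "cmod (f (circlepath c r x)) * (2 * pi * r) / cmod (circlepath c r x - w)
        \<le> cmod (f (circlepath c r x)) * (2 * pi * r) / (r / 2)"
      using d r less_le_trans[of 0 "r / 2" "cmod (circlepath c r x - w)"]
      by (intro divide_left_mono mult_pos_pos) auto
    then show ?thesis
      using r by (simp add: norm_mult norm_divide ac_simps)
  qed
  have "cmod (2 * of_real pi * \<i> * f w) \<le> integral {0..1} (\<lambda>x. 4 * pi * cmod (f (circlepath c r x)))"
    using integral_norm_bound_integral[OF has_integral_integrable[OF 1] int] bd integral_unique[OF 1]
    by simp
  then have 2: "cmod (f w) \<le> 2 * integral {0..1} (\<lambda>x. cmod (f (circlepath c r x)))"
    by (simp add: norm_mult)
  have "((\<lambda>x. cmod (f (circlepath c r x))) has_integral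
      integral {0..1} (\<lambda>x. cmod (f (circlepath c r x)))) {0..1}"
    by (intro integrable_integral integrable_continuous_real continuous_intros cont)
  then have "(\<integral>\<^sup>+x. ennreal (cmod (f (circlepath c r x))) * indicator {0..1} x \<partial>lborel)
      = ennreal (integral {0..1} (\<lambda>x. cmod (f (circlepath c r x))))"
    by (intro nn_integral_has_integral_lebesgue') auto
  moreover have "ennreal (cmod (f w)) \<le> ennreal (2 * integral {0..1} (\<lambda>x. cmod (f (circlepath c r x))))"
    using 2 by (rule ennreal_leI)
  ultimately show ?thesis
    by (simp add: ennreal_mult')
qed

text \<open>The formula on a circle of radius \<open>\<eta> / 2\<close> is averaged over its centre \<open>c\<close>, which runs through the disk
  of radius \<open>\<eta> / 4\<close> around \<open>w\<close>. For a fixed angle the point on the circle is a translate of \<open>c\<close>, so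
  after exchanging the integrals translation invariance of Lebesgue measure bounds the inner integral
  by the integral of \<open>|f|\<close> over \<open>ball w \<eta>\<close>. In contrast to an average over concentric circles
  this needs no polar coordinates; the constant is not optimal, but only its existence matters.\<close>

lemma norm_le_area_mean:
  assumes f: "f holomorphic_on S" and S: "ball w \<eta> \<subseteq> S" and "open S" and \<eta>: "\<eta> > 0"
  shows "ennreal (pi * \<eta>\<^sup>2 / 16) * ennreal (cmod (f w)) \<le>
    2 * (\<integral>\<^sup>+u. ennreal (cmod (f u)) * indicator (ball w \<eta>) u \<partial>lborel)"
proof -
  define g where "g u = (if u \<in> ball w \<eta> then ennreal (cmod (f u)) else 0)" for u
  have fc: "continuous_on (ball w \<eta>) f"
    using f S holomorphic_on_imp_continuous_on holomorphic_on_subset by blast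
  have g: "g \<in> borel_measurable borel"
    unfolding g_def
    by (intro borel_measurable_continuous_on_if) (auto intro!: continuous_intros fc continuous_on_ennreal)
  have circ: "circlepath 0 (\<eta> / 2) \<in> borel_measurable borel"
    unfolding circlepath[abs_def] by (intro borel_measurable_continuous_onI continuous_intros)
  let ?B = "ball w (\<eta> / 4)"
  have B: "emeasure lborel ?B = ennreal (pi * \<eta>\<^sup>2 / 16)"
    using \<eta> by (simp add: emeasure_lborel_ball_complex power_divide)
  have meas: "(\<lambda>(c, x). g (circlepath 0 (\<eta> / 2) x + c) * indicator ?B c * indicator {0..1} x)
      \<in> borel_measurable (lborel \<Otimes>\<^sub>M lborel)"
    unfolding split_beta'
    by (intro borel_measurable_times_ennreal measurable_compose[OF _ g] borel_measurable_add
        measurable_compose[OF measurable_snd] measurable_compose[OF measurable_fst])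
      (auto simp: circ intro!: borel_measurable_indicator)
  have *: "ennreal (cmod (f w)) * indicator ?B c \<le>
     2 * (\<integral>\<^sup>+x. g (circlepath 0 (\<eta> / 2) x + c) * indicator ?B c * indicator {0..1} x \<partial>lborel)" for c
  proof (cases "c \<in> ?B")
    case True
    then have c: "cmod (w - c) < \<eta> / 4" by (simp add: dist_norm)
    have sub: "cball c (\<eta> / 2) \<subseteq> ball w \<eta>"
    proof
      fix u assume "u \<in> cball c (\<eta> / 2)"
      then have "cmod (c - u) \<le> \<eta> / 2" by (simp add: dist_norm)
      then have "cmod (w - u) < \<eta>"
        using c norm_triangle_ineq[of "w - c" "c - u"] \<eta> by simp
      then show "u \<in> ball w \<eta>" by (simp add: dist_norm)
    qed
    have eq: "circlepath 0 (\<eta> / 2) x + c = circlepath c (\<eta> / 2) x" for x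
      by (simp add: circlepath)
    have in': "circlepath c (\<eta> / 2) x \<in> ball w \<eta>" for x
      by (rule subsetD[OF sub]) (use \<eta> in \<open>simp add: circlepath dist_norm norm_mult\<close>)
    have "ennreal (cmod (f w)) \<le>
      2 * (\<integral>\<^sup>+x. ennreal (cmod (f (circlepath c (\<eta> / 2) x))) * indicator {0..1} x \<partial>lborel)"
      using sub S c \<eta> by (intro norm_le_circle_mean[OF f _ \<open>open S\<close>]) auto
    then show ?thesis
      using True in' unfolding eq g_def by simp
  qed simp
  have "ennreal (pi * \<eta>\<^sup>2 / 16) * ennreal (cmod (f w)) =
      (\<integral>\<^sup>+c. ennreal (cmod (f w)) * indicator ?B c \<partial>lborel)"
    by (simp add: nn_integral_cmult_indicator B mult.commute)
  also have "\<dots> \<le> (\<integral>\<^sup>+c. 2 * (\<integral>\<^sup>+x. g (circlepath 0 (\<eta> / 2) x + c) * indicator ?B c * indicator {0..1} x \<partial>lborel) \<partial>lborel)"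
    by (intro nn_integral_mono *)
  also have "\<dots> = 2 * (\<integral>\<^sup>+c. (\<integral>\<^sup>+x. g (circlepath 0 (\<eta> / 2) x + c) * indicator ?B c * indicator {0..1} x \<partial>lborel) \<partial>lborel)"
    using lborel.borel_measurable_nn_integral[OF meas] by (intro nn_integral_cmult) simp
  also have "(\<integral>\<^sup>+c. (\<integral>\<^sup>+x. g (circlepath 0 (\<eta> / 2) x + c) * indicator ?B c * indicator {0..1} x \<partial>lborel) \<partial>lborel) =
     (\<integral>\<^sup>+x. (\<integral>\<^sup>+c. g (circlepath 0 (\<eta> / 2) x + c) * indicator ?B c * indicator {0..1} x \<partial>lborel) \<partial>lborel)"
    using meas by (rule lborel_pair.Fubini'[symmetric])
  also have "\<dots> \<le> (\<integral>\<^sup>+(x :: real). (\<integral>\<^sup>+c. g c \<partial>lborel) * indicator {0..1} x \<partial>lborel)"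
  proof (rule nn_integral_mono)
    fix x :: real
    have "(\<integral>\<^sup>+c. g (circlepath 0 (\<eta> / 2) x + c) * indicator ?B c * indicator {0..1} x \<partial>lborel)
       \<le> (\<integral>\<^sup>+c. g (circlepath 0 (\<eta> / 2) x + c) * indicator {0..1} x \<partial>lborel)"
      by (intro nn_integral_mono) (auto simp: indicator_def)
    also have "\<dots> = (\<integral>\<^sup>+c. g (circlepath 0 (\<eta> / 2) x + c) \<partial>lborel) * indicator {0..1} x"
      by (intro nn_integral_multc measurable_compose[OF _ g]) auto
    also have "(\<integral>\<^sup>+c. g (circlepath 0 (\<eta> / 2) x + c) \<partial>lborel) =
        (\<integral>\<^sup>+c. g c \<partial>distr lborel borel ((+) (circlepath 0 (\<eta> / 2) x)))"
      using g by (subst nn_integral_distr) auto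
    finally show "(\<integral>\<^sup>+c. g (circlepath 0 (\<eta> / 2) x + c) * indicator ?B c * indicator {0..1} x \<partial>lborel)
       \<le> (\<integral>\<^sup>+c. g c \<partial>lborel) * indicator {0..1} x"
      by (simp add: lborel_distr_plus)
  qed
  also have "\<dots> = (\<integral>\<^sup>+c. g c \<partial>lborel)"
    by (simp add: nn_integral_cmult_indicator)
  also have "g = (\<lambda>u. ennreal (cmod (f u)) * indicator (ball w \<eta>) u)"
    by (auto simp: g_def)
  finally show ?thesis
    by (simp add: mult_left_mono)
qed

text \<open>Trades a first power for a \<open>p\<close>-th power, for all \<open>p > 0\<close> at once. If \<open>x > y / 64\<close> then \<open>x / y\<close> lies
  between \<open>1 / 64\<close> and \<open>B\<close>, so that \<open>(x / y) powr (1 - p)\<close> is bounded for either sign of \<open>1 - p\<close>.\<close>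

lemma le_small_plus_powr:
  fixes x y B p :: real
  assumes "0 \<le> x" "x \<le> B * y" "0 < y" "1 \<le> B" "0 < p"
  shows "x \<le> y / 64 + (64 * B) powr \<bar>1 - p\<bar> * y powr (1 - p) * x powr p"
proof (cases "x \<le> y / 64")
  case True
  then show ?thesis using assms by (simp add: add_increasing2)
next
  case False
  then have x: "x > 0" "y / x < 64" using assms by (auto simp: field_simps)
  have "(x / y) powr (1 - p) \<le> (64 * B) powr \<bar>1 - p\<bar>"
  proof (cases "p \<le> 1")
    case True
    have "x / y \<le> 64 * B" using assms by (simp add: field_simps)
    then show ?thesis using True x assms by (simp add: powr_mono2)
  next
    case False
    have "(x / y) powr (1 - p) = (y / x) powr (p - 1)"
      using x assms by (simp add: powr_divide powr_diff field_simps)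
    also have "\<dots> \<le> (64 * B) powr (p - 1)"
      using x assms False by (intro powr_mono2) auto
    finally show ?thesis using False by simp
  qed
  then have "(x / y) powr (1 - p) * (y powr (1 - p) * x powr p)
      \<le> (64 * B) powr \<bar>1 - p\<bar> * (y powr (1 - p) * x powr p)"
    by (intro mult_right_mono) auto
  moreover have "(x / y) powr (1 - p) * (y powr (1 - p) * x powr p) = x"
    using x assms by (simp add: powr_divide flip: powr_add)
  ultimately have "x \<le> (64 * B) powr \<bar>1 - p\<bar> * y powr (1 - p) * x powr p"
    by (simp add: mult.assoc)
  then show ?thesis using assms by simp
qed

lemma measurable_norm_powr_indicator:
  assumes "continuous_on B f" "open B" "p > 0"
  shows "(\<lambda>u. ennreal (cmod (f u) powr p) * indicator B u) \<in> borel_measurable borel"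
proof -
  have "(\<lambda>u. if u \<in> B then ennreal (cmod (f u) powr p) else 0) \<in> borel_measurable borel"
    using assms by (intro borel_measurable_continuous_on_if continuous_on_ennreal continuous_on_powr'
        continuous_on_norm continuous_on_const) auto
  then show ?thesis
    by (rule measurable_cong[THEN iffD1, rotated]) auto
qed

text \<open>If \<open>|f|\<close> is nowhere much larger than at the centre, the inequality for the exponent \<open>1\<close> implies the
  one for the exponent \<open>p\<close>: \<open>le_small_plus_powr\<close> replaces \<open>|f|\<close> in the integral by \<open>|f| powr p\<close>, up to a
  term that the left-hand side absorbs.\<close>

lemma norm_powr_le_area_mean_locally:
  assumes f: "f holomorphic_on S" and S: "ball z d \<subseteq> S" "open S" and d: "d > 0" and p: "p > 0"
    and B: "1 \<le> B" "\<And>u. u \<in> ball z d \<Longrightarrow> cmod (f u) \<le> B * cmod (f z)"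
  shows "ennreal (cmod (f z) powr p * d\<^sup>2) \<le> ennreal (64 * (64 * B) powr \<bar>1 - p\<bar>) *
    (\<integral>\<^sup>+u. ennreal (cmod (f u) powr p) * indicator (ball z d) u \<partial>lborel)"
    (is "_ \<le> ennreal (64 * ?K) * ?J")
proof (cases "f z = 0 \<or> ?J = \<infinity>")
  case True
  have "?K > 0" using B by simp
  then show ?thesis using True p by (auto simp: ennreal_mult_top)
next
  case False
  define y where "y = cmod (f z)"
  have y: "y > 0" using False by (simp add: y_def)
  have fc: "continuous_on (ball z d) f"
    using f S holomorphic_on_imp_continuous_on holomorphic_on_subset by blast
  have meas: "(\<lambda>u. ennreal (cmod (f u) powr p) * indicator (ball z d) u) \<in> borel_measurable borel"
    using fc p by (intro measurable_norm_powr_indicator) auto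
  obtain J where J: "?J = ennreal J" "J \<ge> 0"
    using False by (cases ?J) auto
  let ?L = "?K * y powr (1 - p)"
  have two: "2 * ennreal x = ennreal (2 * x)" for x
    by (simp add: ennreal_mult')
  have "ennreal (pi * d\<^sup>2 / 16) * ennreal y \<le>
    2 * (\<integral>\<^sup>+u. ennreal (cmod (f u)) * indicator (ball z d) u \<partial>lborel)"
    unfolding y_def by (rule norm_le_area_mean[OF f S d])
  also have "(\<integral>\<^sup>+u. ennreal (cmod (f u)) * indicator (ball z d) u \<partial>lborel) \<le>
     (\<integral>\<^sup>+u. ennreal (y / 64) * indicator (ball z d) u +
         ennreal ?L * (ennreal (cmod (f u) powr p) * indicator (ball z d) u) \<partial>lborel)"
  proof (intro nn_integral_mono)
    fix u
    show "ennreal (cmod (f u)) * indicator (ball z d) u \<le> ennreal (y / 64) * indicator (ball z d) u +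
         ennreal ?L * (ennreal (cmod (f u) powr p) * indicator (ball z d) u)"
    proof (cases "u \<in> ball z d")
      case True
      have "cmod (f u) \<le> y / 64 + ?L * cmod (f u) powr p"
        using B True y p by (intro le_small_plus_powr) (auto simp: y_def)
      then have "ennreal (cmod (f u)) \<le> ennreal (y / 64 + ?L * cmod (f u) powr p)"
        by (rule ennreal_leI)
      then show ?thesis using True y by (simp add: ennreal_plus ennreal_mult)
    qed simp
  qed
  also have "\<dots> = ennreal (y / 64) * ennreal (pi * d\<^sup>2) + ennreal ?L * ennreal J"
    using d meas by (subst nn_integral_add)
      (auto intro!: borel_measurable_times_ennreal borel_measurable_indicator simp: nn_integral_cmult nn_integral_cmult_indicator emeasure_lborel_ball_complex J)
  also have "\<dots> = ennreal (y / 64 * (pi * d\<^sup>2) + ?L * J)"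
  proof -
    have "ennreal (y / 64) * ennreal (pi * d\<^sup>2) = ennreal (y / 64 * (pi * d\<^sup>2))"
      using y by (intro ennreal_mult[symmetric]) auto
    moreover have "ennreal ?L * ennreal J = ennreal (?L * J)"
      using J by (intro ennreal_mult[symmetric]) auto
    ultimately show ?thesis
      using y J by (simp only:) (intro ennreal_plus[symmetric]; simp)
  qed
  also have "2 * \<dots> = ennreal (2 * (y / 64 * (pi * d\<^sup>2) + ?L * J))"
    by (rule two)
  finally have "ennreal (pi * d\<^sup>2 / 16 * y) \<le> ennreal (2 * (y / 64 * (pi * d\<^sup>2) + ?L * J))"
    unfolding ennreal_mult''[OF less_imp_le[OF y]] by (simp add: mult_left_mono)
  then have "pi * d\<^sup>2 / 16 * y \<le> 2 * (y / 64 * (pi * d\<^sup>2) + ?L * J)"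
    using y J by (subst (asm) ennreal_le_iff) auto
  \<comment> \<open>The share \<open>y / 64\<close> contributes half of the left-hand side and is absorbed there.\<close>
  then have *: "pi * d\<^sup>2 * y \<le> 64 * (?L * J)"
    by argo
  have "1 * (d\<^sup>2 * y) \<le> pi * (d\<^sup>2 * y)"
    using y pi_gt3 by (intro mult_right_mono) auto
  with * have "d\<^sup>2 * y \<le> 64 * (?L * J)" by argo
  then have "(d\<^sup>2 * y) * y powr (p - 1) \<le> 64 * (?L * J) * y powr (p - 1)"
    by (intro mult_right_mono) auto
  moreover have "y * y powr (p - 1) = y powr p" "y powr (1 - p) * y powr (p - 1) = 1"
    using y by (simp_all add: powr_diff)
  then have "(d\<^sup>2 * y) * y powr (p - 1) = y powr p * d\<^sup>2"
    "64 * (?L * J) * y powr (p - 1) = 64 * ?K * J"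
    by (simp_all add: ac_simps)
  ultimately have "y powr p * d\<^sup>2 \<le> 64 * ?K * J" by linarith
  then show ?thesis
    unfolding J y_def[symmetric] using J(2) by (simp add: ennreal_leI flip: ennreal_mult)
qed

text \<open>The mean value inequality for \<open>|f| powr p\<close> for all \<open>p > 0\<close>. For \<open>p < 1\<close> it does not follow from convexity, and
  zeros of \<open>f\<close> prevent taking a holomorphic \<open>p\<close>-th power. Instead, let \<open>z\<close> maximize
  \<open>(\<eta> - |z - w|) powr (2 / p) |f z|\<close>. On the disk around \<open>z\<close> with half the distance to the
  boundary as radius, \<open>|f|\<close> is at most \<open>2 powr (2 / p) |f z|\<close>, so the previous lemma applies to \<open>z\<close>. By
  maximality the bound at \<open>z\<close> gives the bound at \<open>w\<close>; the exponent \<open>2 / p\<close> is the one for which the radii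
  cancel.\<close>

lemma norm_powr_le_area_mean:
  assumes f: "f holomorphic_on S" and S: "cball w \<eta> \<subseteq> S" "open S" and \<eta>: "\<eta> > 0" and p: "p > 0"
  shows "ennreal (cmod (f w) powr p * \<eta>\<^sup>2) \<le> ennreal (256 * (64 * 2 powr (2 / p)) powr \<bar>1 - p\<bar>) *
    (\<integral>\<^sup>+u. ennreal (cmod (f u) powr p) * indicator (ball w \<eta>) u \<partial>lborel)"
proof (cases "f w = 0")
  case False
  define h where "h z = (\<eta> - cmod (z - w)) powr (2 / p) * cmod (f z)" for z
  have fc: "continuous_on (cball w \<eta>) f"
    using f S holomorphic_on_imp_continuous_on holomorphic_on_subset by blast
  have "continuous_on (cball w \<eta>) h"
    unfolding h_def using p
    by (intro continuous_on_mult continuous_on_powr' continuous_on_norm continuous_on_diff fc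
        continuous_on_const continuous_on_id) (auto simp: dist_norm norm_minus_commute)
  then obtain z where z: "z \<in> cball w \<eta>" "\<And>u. u \<in> cball w \<eta> \<Longrightarrow> h u \<le> h z"
    using continuous_attains_sup[of "cball w \<eta>" h] \<eta> by auto
  have "h w > 0" using \<eta> False by (simp add: h_def)
  then have hz: "h w \<le> h z" "h z > 0" using z(2)[of w] \<eta> by auto
  \<comment> \<open>Half the distance to the boundary: on \<open>ball z d\<close> the weight in \<open>h\<close> drops by a factor of at most \<open>2 powr (2 / p)\<close>.\<close>
  define d where "d = (\<eta> - cmod (z - w)) / 2"
  have "cmod (z - w) \<le> \<eta>" using z by (simp add: dist_norm norm_minus_commute)
  moreover have "cmod (z - w) \<noteq> \<eta>" using hz by (auto simp: h_def)
  ultimately have d: "d > 0" by (simp add: d_def)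
  have fz: "cmod (f z) > 0" using hz by (auto simp: h_def)
  have far: "d \<le> \<eta> - cmod (u - w)" if "u \<in> ball z d" for u
    using that norm_triangle_ineq[of "u - z" "z - w"] by (simp add: d_def dist_norm norm_minus_commute)
  then have sub: "ball z d \<subseteq> ball w \<eta>"
    using d by (force simp: dist_norm norm_minus_commute)
  then have sub': "ball z d \<subseteq> S"
    using S(1) ball_subset_cball by blast
  have "cmod (f u) \<le> 2 powr (2 / p) * cmod (f z)" if u: "u \<in> ball z d" for u
  proof -
    have "d powr (2 / p) * cmod (f u) \<le> h u"
      unfolding h_def using far[OF u] d p by (intro mult_right_mono powr_mono2) auto
    also have "\<dots> \<le> h z" using sub u by (intro z) auto
    also have "h z = d powr (2 / p) * (2 powr (2 / p) * cmod (f z))"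
      using d by (simp add: h_def d_def powr_divide)
    finally show ?thesis using d by simp
  qed
  moreover have "1 \<le> 2 powr (2 / p)" using p by (simp add: ge_one_powr_ge_zero)
  ultimately have "ennreal (cmod (f z) powr p * d\<^sup>2) \<le> ennreal (64 * (64 * 2 powr (2 / p)) powr \<bar>1 - p\<bar>) *
    (\<integral>\<^sup>+u. ennreal (cmod (f u) powr p) * indicator (ball z d) u \<partial>lborel)"
    using f S(2) p d sub' by (intro norm_powr_le_area_mean_locally[where S = S]) auto
  also have "\<dots> \<le> ennreal (64 * (64 * 2 powr (2 / p)) powr \<bar>1 - p\<bar>) *
    (\<integral>\<^sup>+u. ennreal (cmod (f u) powr p) * indicator (ball w \<eta>) u \<partial>lborel)"
    using sub by (intro mult_left_mono nn_integral_mono) (auto simp: indicator_def)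
  finally have 1: "ennreal 4 * ennreal (cmod (f z) powr p * d\<^sup>2) \<le> ennreal 4 *
    (ennreal (64 * (64 * 2 powr (2 / p)) powr \<bar>1 - p\<bar>) *
    (\<integral>\<^sup>+u. ennreal (cmod (f u) powr p) * indicator (ball w \<eta>) u \<partial>lborel))"
    by (rule mult_left_mono) simp
  have hp: "h u powr p = (\<eta> - cmod (u - w))\<^sup>2 * cmod (f u) powr p" if "\<eta> - cmod (u - w) > 0" for u
    using that p by (simp add: h_def powr_mult powr_powr)
  have "cmod (f w) powr p * \<eta>\<^sup>2 = h w powr p" using hp[of w] \<eta> by simp
  also have "\<dots> \<le> h z powr p" using hz \<open>h w > 0\<close> p by (intro powr_mono2) auto
  also have "\<dots> = 4 * (cmod (f z) powr p * d\<^sup>2)"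
    using hp[of z] d by (simp add: d_def power_divide)
  finally have "ennreal (cmod (f w) powr p * \<eta>\<^sup>2) \<le> ennreal (4 * (cmod (f z) powr p * d\<^sup>2))"
    by (rule ennreal_leI)
  also have "\<dots> = ennreal 4 * ennreal (cmod (f z) powr p * d\<^sup>2)"
    by (rule ennreal_mult') simp
  also note 1
  also have "ennreal 4 * (ennreal (64 * (64 * 2 powr (2 / p)) powr \<bar>1 - p\<bar>) * J) =
      ennreal (256 * (64 * 2 powr (2 / p)) powr \<bar>1 - p\<bar>) * J" for J
    unfolding mult.assoc[symmetric] by (subst ennreal_mult[symmetric]) auto
  finally show ?thesis .
qed (use p in simp)

text \<open>The mean value inequality on a Euclidean disk around \<open>w\<close> that fits into the larger pseudohyperbolic
  disk, with the radius expressed by the defect at the centre \<open>a\<close>.\<close>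

lemma norm_powr_le_interior_mean:
  assumes r: "0 < r" "r < 1" and p: "p > (0 :: real)"
  shows "\<exists>K>0. \<forall>f. f holomorphic_on \<bbbD> \<longrightarrow> (\<forall>a\<in>\<bbbD>. \<forall>w\<in>pseudohyperbolic_disk a r.
    ennreal (cmod (f w) powr p * (1 - (cmod a)\<^sup>2)\<^sup>2) \<le> ennreal K *
    (\<integral>\<^sup>+u. ennreal (cmod (f u) powr p) * indicator (pseudohyperbolic_disk a ((1 + r) / 2)) u \<partial>lborel))"
proof -
  have r2: "1 - r\<^sup>2 > 0" using r by (simp add: power_less_one_iff)
  \<comment> \<open>The first factor makes room in the larger disk, with a closed Euclidean disk of half the admissible radius; the second passes from the defect at \<open>w\<close> to the one at \<open>a\<close>.\<close>
  define c where "c = (1 - r) / 16 * ((1 - r\<^sup>2) / 4)"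
  have c: "c > 0" using r r2 by (simp add: c_def)
  define K where "K = 256 * (64 * 2 powr (2 / p)) powr \<bar>1 - p\<bar>"
  have K: "K > 0" by (simp add: K_def)
  have "ennreal (cmod (f w) powr p * (1 - (cmod a)\<^sup>2)\<^sup>2) \<le> ennreal (K / c\<^sup>2) *
    (\<integral>\<^sup>+u. ennreal (cmod (f u) powr p) * indicator (pseudohyperbolic_disk a ((1 + r) / 2)) u \<partial>lborel)"
    if f: "f holomorphic_on \<bbbD>" and aD: "a \<in> \<bbbD>" and w: "w \<in> pseudohyperbolic_disk a r" for f a w
  proof -
    let ?E = "pseudohyperbolic_disk a ((1 + r) / 2)"
    define \<eta> where "\<eta> = (1 - r) / 16 * (1 - (cmod w)\<^sup>2)"
    have a: "cmod a < 1" using aD by simp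
    have w1: "cmod w < 1" "cmod (a - w) \<le> r * cmod (1 - cnj a * w)"
      using w mem_pseudohyperbolic_disk[OF a] by auto
    have d: "1 - (cmod w)\<^sup>2 > 0" using defect_pos[OF w1(1)] .
    then have \<eta>: "\<eta> > 0" using r by (simp add: \<eta>_def)
    have "(1 - r\<^sup>2) / 4 * (1 - (cmod a)\<^sup>2) \<le> (1 - r\<^sup>2) / 4 * (2 * cmod (1 - cnj a * w))"
      using norm_one_minus_cnj_mult_ge(1)[OF a w1(1)] r2 by (intro mult_left_mono) auto
    also have "\<dots> \<le> 1 - (cmod w)\<^sup>2"
      using defect_comparable(2)[OF a w r] by simp
    finally have "(1 - r) / 16 * ((1 - r\<^sup>2) / 4 * (1 - (cmod a)\<^sup>2)) \<le> \<eta>"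
      unfolding \<eta>_def using r by (intro mult_left_mono) auto
    then have "c * (1 - (cmod a)\<^sup>2) \<le> \<eta>" by (simp add: c_def)
    then have "(c * (1 - (cmod a)\<^sup>2))\<^sup>2 \<le> \<eta>\<^sup>2"
      using c defect_pos[OF a] by (intro power_mono) auto
    then have "(1 - (cmod a)\<^sup>2)\<^sup>2 \<le> \<eta>\<^sup>2 / c\<^sup>2"
      using c by (simp add: power_mult_distrib pos_le_divide_eq mult.commute)
    then have "cmod (f w) powr p * (1 - (cmod a)\<^sup>2)\<^sup>2 \<le> cmod (f w) powr p * (\<eta>\<^sup>2 / c\<^sup>2)"
      by (intro mult_left_mono) auto
    then have "ennreal (cmod (f w) powr p * (1 - (cmod a)\<^sup>2)\<^sup>2) \<le> ennreal (1 / c\<^sup>2 * (cmod (f w) powr p * \<eta>\<^sup>2))"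
      by (intro ennreal_leI) simp
    also have "\<dots> = ennreal (1 / c\<^sup>2) * ennreal (cmod (f w) powr p * \<eta>\<^sup>2)"
      by (rule ennreal_mult) auto
    finally have 1: "ennreal (cmod (f w) powr p * (1 - (cmod a)\<^sup>2)\<^sup>2) \<le>
      ennreal (1 / c\<^sup>2) * ennreal (cmod (f w) powr p * \<eta>\<^sup>2)" .
    have sub: "cball w \<eta> \<subseteq> ?E"
    proof
      fix u assume "u \<in> cball w \<eta>"
      then have "cmod (w - u) \<le> \<eta>" by (simp add: dist_norm)
      also have "\<eta> < (1 - r) / 8 * (1 - (cmod w)\<^sup>2)" unfolding \<eta>_def using d r by simp
      finally show "u \<in> ?E" using r by (intro ball_subset_pseudohyperbolic_disk[OF a w1]) auto
    qed
    have "cball w \<eta> \<subseteq> \<bbbD>" using sub by (auto simp: pseudohyperbolic_disk_def)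
    then have "ennreal (cmod (f w) powr p * \<eta>\<^sup>2) \<le> ennreal K *
      (\<integral>\<^sup>+u. ennreal (cmod (f u) powr p) * indicator (ball w \<eta>) u \<partial>lborel)"
      unfolding K_def by (intro norm_powr_le_area_mean[OF f]) (use \<eta> p in auto)
    also have "\<dots> \<le> ennreal K * (\<integral>\<^sup>+u. ennreal (cmod (f u) powr p) * indicator ?E u \<partial>lborel)"
      using sub ball_subset_cball[of w \<eta>]
      by (intro mult_left_mono nn_integral_mono) (auto simp: indicator_def)
    finally have 2: "ennreal (1 / c\<^sup>2) * ennreal (cmod (f w) powr p * \<eta>\<^sup>2) \<le> ennreal (1 / c\<^sup>2) *
        (ennreal K * (\<integral>\<^sup>+u. ennreal (cmod (f u) powr p) * indicator ?E u \<partial>lborel))"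
      by (rule mult_left_mono) simp
    note 1
    also note 2
    also have "ennreal (1 / c\<^sup>2) *
        (ennreal K * (\<integral>\<^sup>+u. ennreal (cmod (f u) powr p) * indicator ?E u \<partial>lborel)) =
        ennreal (K / c\<^sup>2) * (\<integral>\<^sup>+u. ennreal (cmod (f u) powr p) * indicator ?E u \<partial>lborel)"
      using K by (simp add: mult.assoc[symmetric] ennreal_mult[symmetric])
    finally show ?thesis .
  qed
  then show ?thesis using K c by (intro exI[of _ "K / c\<^sup>2"]) auto
qed

section \<open>Integral of a power of the kernel\<close>

text \<open>For \<open>z\<close> away from \<open>0\<close> this set lies in a disk of radius \<open>2 s\<close> around the reflected point
  \<open>1 / cnj z\<close>. For small \<open>z\<close> the kernel is at least \<open>1 / 2\<close>, so the set is empty unless \<open>s\<close> exceeds \<open>1 / 2\<close>,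
  and then the area of the whole unit disk is small enough.\<close>

lemma area_near_boundary_point:
  assumes z: "cmod z < 1" and s: "s > 0"
  shows "emeasure lborel {w \<in> \<bbbD>. cmod (1 - cnj z * w) < s} \<le> ennreal (4 * pi * s\<^sup>2)"
proof (cases "cmod z < 1 / 2")
  case False
  then have z0: "z \<noteq> 0" by auto
  with False have z1: "1 / cmod z \<le> 2" by (simp add: divide_le_eq)
  have "{w \<in> \<bbbD>. cmod (1 - cnj z * w) < s} \<subseteq> ball (1 / cnj z) (2 * s)"
  proof clarify
    fix w assume w: "cmod (1 - cnj z * w) < s"
    have "1 / cnj z - w = (1 - cnj z * w) / cnj z"
      using z0 by (simp add: diff_divide_distrib)
    then have "cmod (1 / cnj z - w) = 1 / cmod z * cmod (1 - cnj z * w)"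
      by (simp add: norm_divide)
    also have "\<dots> \<le> 2 * cmod (1 - cnj z * w)"
      using z1 by (intro mult_right_mono) auto
    also have "\<dots> < 2 * s" using w by simp
    finally show "w \<in> ball (1 / cnj z) (2 * s)" by (simp add: dist_norm)
  qed
  then have "emeasure lborel {w \<in> \<bbbD>. cmod (1 - cnj z * w) < s} \<le> emeasure lborel (ball (1 / cnj z) (2 * s))"
    by (intro emeasure_mono) auto
  then show ?thesis
    using s by (simp add: emeasure_lborel_ball_complex power_mult_distrib ac_simps)
next
  case True
  have half: "1 / 2 \<le> cmod (1 - cnj z * w)" if "w \<in> \<bbbD>" for w
  proof -
    have "cmod (cnj z * w) \<le> 1 / 2 * 1"
      unfolding norm_mult complex_mod_cnj using True that by (intro mult_mono) auto
    then show ?thesis using norm_triangle_ineq2[of 1 "cnj z * w"] by simp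
  qed
  show ?thesis
  proof (cases "s \<le> 1 / 2")
    case True
    then have "{w \<in> \<bbbD>. cmod (1 - cnj z * w) < s} = {}"
      using half by fastforce
    then show ?thesis by (simp only: emeasure_empty zero_le)
  next
    case False
    then have "(1 / 2)\<^sup>2 \<le> s\<^sup>2" by (intro power_mono) auto
    then have s2: "pi \<le> 4 * pi * s\<^sup>2" by (simp add: power2_eq_square field_simps)
    have "emeasure lborel {w \<in> \<bbbD>. cmod (1 - cnj z * w) < s} \<le> emeasure lborel (ball (0::complex) 1)"
      by (intro emeasure_mono) auto
    also have "\<dots> = ennreal pi" by (simp add: emeasure_lborel_ball_complex)
    also have "\<dots> \<le> ennreal (4 * pi * s\<^sup>2)" using s2 by (rule ennreal_leI)
    finally show ?thesis .
  qed
qed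

lemma dyadic_bracket:
  fixes x :: real
  assumes "1 \<le> x"
  obtains n :: nat where "2 ^ n \<le> x" "x < 2 ^ (n + 1)"
proof -
  have "\<exists>n. x < 2 ^ n" by (rule real_arch_pow) simp
  define m where "m = (LEAST n. x < 2 ^ n)"
  have m: "x < 2 ^ m" unfolding m_def by (rule LeastI_ex) fact
  then obtain n where n: "m = Suc n" using assms by (cases m) auto
  then have "\<not> x < 2 ^ n" using not_less_Least[of n "\<lambda>n. x < 2 ^ n"] by (simp add: m_def)
  with m n show ?thesis by (intro that[of n]) auto
qed

text \<open>The disk is split dyadically according to the size of \<open>|1 - cnj z w|\<close>, starting from its minimal
  order \<open>h = (1 - |z|\<^sup>2) / 2\<close>. The part where it is about \<open>2\<^sup>n h\<close> has area of order \<open>4\<^sup>n h\<^sup>2\<close> and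
  contributes \<open>(2\<^sup>n h) powr (2 - \<gamma>)\<close>; for \<open>\<gamma> > 2\<close> these terms form a convergent geometric series.\<close>

lemma Forelli_Rudin_estimate:
  assumes \<gamma>: "\<gamma> > 2" and z: "cmod z < 1"
  shows "(\<integral>\<^sup>+w. ennreal (cmod (1 - cnj z * w) powr - \<gamma>) * indicator \<bbbD> w \<partial>lborel)
     \<le> ennreal (16 * pi / (1 - 2 powr (2 - \<gamma>)) * 2 powr (\<gamma> - 2) * (1 - (cmod z)\<^sup>2) powr (2 - \<gamma>))"
proof -
  define h where "h = (1 - (cmod z)\<^sup>2) / 2"
  have h: "h > 0" using defect_pos[OF z] by (simp add: h_def)
  define A where "A n = {w \<in> \<bbbD>. cmod (1 - cnj z * w) < 2 ^ (n + 1) * h}" for n :: nat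
  have A: "A n \<in> sets borel" for n
  proof -
    have "open (A n)"
      unfolding A_def Collect_conj_eq Collect_mem_eq by (intro open_Int open_Collect_less continuous_intros open_ball)
    then show ?thesis by simp
  qed
  let ?q = "2 powr (2 - \<gamma>)"
  have q: "0 < ?q" "?q < 1" using \<gamma> by (auto simp: powr_less_one)
  have le: "T n \<le> suminf T" for T :: "nat \<Rightarrow> ennreal" and n
    using sum_le_suminf[of T "{n}"] by (simp add: summableI)
  have "ennreal (cmod (1 - cnj z * w) powr - \<gamma>) * indicator \<bbbD> w \<le>
     (\<Sum>n. ennreal ((2 ^ n * h) powr - \<gamma>) * indicator (A n) w)" for w
  proof (cases "w \<in> \<bbbD>")
    case True
    then have "1 \<le> cmod (1 - cnj z * w) / h"
      using norm_one_minus_cnj_mult_ge(1)[OF z, of w] h by (simp add: h_def field_simps)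
    then obtain n where n: "2 ^ n \<le> cmod (1 - cnj z * w) / h" "cmod (1 - cnj z * w) / h < 2 ^ (n + 1)"
      by (rule dyadic_bracket)
    then have w: "w \<in> A n" using True h by (simp add: A_def field_simps)
    have "cmod (1 - cnj z * w) powr - \<gamma> \<le> (2 ^ n * h) powr - \<gamma>"
      using n h \<gamma> by (intro powr_mono2') (auto simp: field_simps)
    then have "ennreal (cmod (1 - cnj z * w) powr - \<gamma>) * indicator \<bbbD> w \<le>
        ennreal ((2 ^ n * h) powr - \<gamma>) * indicator (A n) w"
      using w True by (simp add: ennreal_leI)
    also have "\<dots> \<le> (\<Sum>n. ennreal ((2 ^ n * h) powr - \<gamma>) * indicator (A n) w)"
      by (rule le)
    finally show ?thesis .
  qed simp
  then have "(\<integral>\<^sup>+w. ennreal (cmod (1 - cnj z * w) powr - \<gamma>) * indicator \<bbbD> w \<partial>lborel) \<le>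
      (\<integral>\<^sup>+w. (\<Sum>n. ennreal ((2 ^ n * h) powr - \<gamma>) * indicator (A n) w) \<partial>lborel)"
    by (intro nn_integral_mono)
  also have "\<dots> = (\<Sum>n. \<integral>\<^sup>+w. ennreal ((2 ^ n * h) powr - \<gamma>) * indicator (A n) w \<partial>lborel)"
    using A by (intro nn_integral_suminf) (auto intro!: borel_measurable_times_ennreal borel_measurable_indicator)
  also have "\<dots> = (\<Sum>n. ennreal ((2 ^ n * h) powr - \<gamma>) * emeasure lborel (A n))"
    using A by (simp add: nn_integral_cmult_indicator)
  also have "\<dots> \<le> (\<Sum>n. ennreal (16 * pi * h powr (2 - \<gamma>) * ?q ^ n))"
  proof (intro suminf_le summableI)
    fix n
    have "ennreal ((2 ^ n * h) powr - \<gamma>) * emeasure lborel (A n) \<le>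
      ennreal ((2 ^ n * h) powr - \<gamma>) * ennreal (4 * pi * (2 ^ (n + 1) * h)\<^sup>2)"
      unfolding A_def using h z by (intro mult_left_mono area_near_boundary_point) auto
    also have "\<dots> = ennreal ((2 ^ n * h) powr - \<gamma> * (4 * pi * (2 ^ (n + 1) * h)\<^sup>2))"
      by (intro ennreal_mult[symmetric]) auto
    also have "(2 ^ n * h) powr - \<gamma> * (4 * pi * (2 ^ (n + 1) * h)\<^sup>2) =
        16 * pi * (2 ^ n * h) powr (2 - \<gamma>)"
      using h by (simp add: powr_diff powr_minus power_mult_distrib field_simps)
    also have "(2 ^ n * h) powr (2 - \<gamma>) = h powr (2 - \<gamma>) * ?q ^ n"
      using h by (simp add: powr_mult powr_powr ac_simps flip: powr_realpow)
    finally show "ennreal ((2 ^ n * h) powr - \<gamma>) * emeasure lborel (A n) \<le>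
        ennreal (16 * pi * h powr (2 - \<gamma>) * ?q ^ n)" by (simp add: ac_simps)
  qed
  also have "\<dots> = ennreal (\<Sum>n. 16 * pi * h powr (2 - \<gamma>) * ?q ^ n)"
    using q by (intro suminf_ennreal_eq[OF _ summable_sums] summable_mult summable_geometric) auto
  also have "(\<Sum>n. 16 * pi * h powr (2 - \<gamma>) * ?q ^ n) = 16 * pi * h powr (2 - \<gamma>) / (1 - ?q)"
    using q by (simp add: suminf_mult suminf_geometric summable_geometric)
  also have "h powr (2 - \<gamma>) = 2 powr (\<gamma> - 2) * (1 - (cmod z)\<^sup>2) powr (2 - \<gamma>)"
    using defect_pos[OF z] powr_minus_divide[of 2 "2 - \<gamma>"] by (simp add: h_def powr_divide)
  finally show ?thesis by (simp add: ac_simps)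
qed

section \<open>Lattices\<close>

text \<open>Pseudohyperbolic separation, with the quotient \<open>|x - y| / |1 - cnj x y|\<close> cleared of its denominator.\<close>

definition separated :: "real \<Rightarrow> complex set \<Rightarrow> bool" where
  "separated r S \<longleftrightarrow> S \<subseteq> \<bbbD> \<and>
     (\<forall>x\<in>S. \<forall>y\<in>S. x \<noteq> y \<longrightarrow> r * cmod (1 - cnj x * y) \<le> cmod (x - y))"

text \<open>A maximal separated set, which exists by Zorn's lemma, covers: a point outside all disks could be
  added to it.\<close>

lemma ex_separated_cover:
  assumes "0 < r" "r < 1"
  obtains S where "separated r S" "\<And>w. w \<in> \<bbbD> \<Longrightarrow> \<exists>z\<in>S. w \<in> pseudohyperbolic_disk z r"
proof -
  have "\<exists>M\<in>{S. separated r S}. \<forall>X\<in>{S. separated r S}. M \<subseteq> X \<longrightarrow> X = M"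
  proof (rule subset_Zorn')
    fix C assume C: "subset.chain {S. separated r S} C"
    have sep: "separated r X" if "X \<in> C" for X using C that by (auto simp: subset.chain_def)
    have "r * cmod (1 - cnj x * y) \<le> cmod (x - y)" if xy: "x \<in> \<Union>C" "y \<in> \<Union>C" "x \<noteq> y" for x y
    proof -
      obtain X Y where XY: "X \<in> C" "x \<in> X" "Y \<in> C" "y \<in> Y" using xy by auto
      then have "X \<subseteq> Y \<or> Y \<subseteq> X" using C by (auto simp: subset.chain_def)
      then show ?thesis using sep XY xy(3) unfolding separated_def by (metis subsetD)
    qed
    then show "\<Union>C \<in> {S. separated r S}"
      using sep by (auto simp: separated_def)
  qed
  then obtain S where S: "separated r S" "\<And>X. separated r X \<Longrightarrow> S \<subseteq> X \<Longrightarrow> X = S" by auto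
  have "\<exists>z\<in>S. w \<in> pseudohyperbolic_disk z r" if w: "w \<in> \<bbbD>" for w
  proof (rule ccontr)
    assume neg: "\<not> (\<exists>z\<in>S. w \<in> pseudohyperbolic_disk z r)"
    have *: "r * cmod (1 - cnj z * w) \<le> cmod (z - w)" if "z \<in> S" for z
      using neg that w S(1) mem_pseudohyperbolic_disk[of z w r] by (force simp: separated_def)
    moreover have "r * cmod (1 - cnj w * z) \<le> cmod (w - z)" if "z \<in> S" for z
      using *[OF that] by (metis norm_minus_commute norm_one_minus_cnj_mult_commute)
    ultimately have "separated r (insert w S)"
      using S(1) w unfolding separated_def by auto
    then have "w \<in> S" using S(2)[of "insert w S"] by auto
    moreover have "w \<in> pseudohyperbolic_disk w r"
      using w assms norm_one_minus_cnj_mult_ge(3)[of w w] mem_pseudohyperbolic_disk[of w w r] by simp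
    ultimately show False using neg by blast
  qed
  with S(1) show ?thesis by (rule that)
qed

text \<open>A common point would make \<open>|x - y|\<close> smaller than \<open>r / 4\<close> times the sum of the two defects, each of which
  is at most \<open>2 |1 - cnj x y|\<close>.\<close>

lemma disjoint_balls_if_separated:
  assumes S: "separated r S" and r: "0 < r" and xy: "x \<in> S" "y \<in> S" "x \<noteq> y"
  shows "ball x (r / 4 * (1 - (cmod x)\<^sup>2)) \<inter> ball y (r / 4 * (1 - (cmod y)\<^sup>2)) = {}"
proof (rule ccontr)
  let ?k = "cmod (1 - cnj x * y)"
  assume "\<not> ?thesis"
  then obtain u where u: "dist x u < r / 4 * (1 - (cmod x)\<^sup>2)" "dist y u < r / 4 * (1 - (cmod y)\<^sup>2)"
    by auto
  have D: "cmod x < 1" "cmod y < 1" using S xy by (auto simp: separated_def)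
  have "r / 4 * (1 - (cmod x)\<^sup>2) \<le> r / 4 * (2 * ?k)" "r / 4 * (1 - (cmod y)\<^sup>2) \<le> r / 4 * (2 * ?k)"
    using norm_one_minus_cnj_mult_ge[OF D] r by (intro mult_left_mono; simp)+
  then have "dist x y < r * ?k"
    using u dist_triangle2[of x y u] by linarith
  moreover have "r * ?k \<le> dist x y" using S xy by (simp add: separated_def dist_norm)
  ultimately show False by simp
qed

text \<open>Disjoint nonempty open sets are countably many.\<close>

lemma countable_separated:
  assumes S: "separated r S" and r: "0 < r"
  shows "countable S"
proof -
  define B where "B z = ball z (r / 4 * (1 - (cmod z)\<^sup>2))" for z
  have disj: "B x \<inter> B y = {}" if "x \<in> S" "y \<in> S" "x \<noteq> y" for x y
    unfolding B_def using disjoint_balls_if_separated[OF S r that] .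
  have ne: "x \<in> B x" if "x \<in> S" for x
    using that S r defect_pos[of x] by (auto simp: B_def separated_def)
  have "countable (B ` S)"
    using disj by (intro countable_disjoint_open_subsets) (auto simp: B_def pairwise_def disjnt_def)
  moreover have "inj_on B S"
    using disj ne by (intro inj_onI) blast
  ultimately show ?thesis by (rule countable_image_inj_on)
qed

text \<open>Needed because a lattice is a sequence with finite multiplicities: finitely many centres could not be
  enumerated by the natural numbers. Each disk stays away from the unit circle, so finitely many
  of them do not reach the points near \<open>1\<close>.\<close>

lemma infinite_if_pseudohyperbolic_cover:
  assumes S: "S \<subseteq> \<bbbD>" and r: "0 < r" "r < 1"
    and cover: "\<And>w. w \<in> \<bbbD> \<Longrightarrow> \<exists>z\<in>S. w \<in> pseudohyperbolic_disk z r"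
  shows "infinite S"
proof
  assume fin: "finite S"
  have ne: "S \<noteq> {}" using cover[of 0] by auto
  define m where "m = Min ((\<lambda>z. (1 - r\<^sup>2) / 4 * (1 - (cmod z)\<^sup>2)) ` S)"
  have r2: "1 - r\<^sup>2 > 0" using r by (simp add: power_less_one_iff)
  have "m > 0"
    unfolding m_def using fin ne S r2 defect_pos by (subst Min_gr_iff) auto
  define e where "e = min (m / 4) (1 / 2)"
  have e: "0 < e" "e \<le> m / 4" "e \<le> 1 / 2" using \<open>m > 0\<close> by (auto simp: e_def)
  define w :: complex where "w = of_real (1 - e)"
  have w: "cmod w = 1 - e" using e by (simp add: w_def del: of_real_diff)
  then have w1: "cmod w < 1" using e by simp
  then obtain z where z: "z \<in> S" "w \<in> pseudohyperbolic_disk z r" using cover[of w] by auto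
  have z1: "cmod z < 1" using z S by auto
  have "m \<le> (1 - r\<^sup>2) / 4 * (1 - (cmod z)\<^sup>2)"
    unfolding m_def using fin z by (intro Min_le) auto
  also have "\<dots> \<le> (1 - r\<^sup>2) / 4 * (2 * cmod (1 - cnj z * w))"
    using norm_one_minus_cnj_mult_ge(1)[OF z1 w1] r2 by (intro mult_left_mono) auto
  also have "\<dots> \<le> 1 - (cmod w)\<^sup>2"
    using defect_comparable(2)[OF z1 z(2) r] by simp
  also have "\<dots> \<le> 2 * e" unfolding w by (simp add: power2_eq_square algebra_simps)
  also have "\<dots> \<le> m / 2" using e by simp
  finally show False using \<open>m > 0\<close> by simp
qed

text \<open>If \<open>w\<close> lies in the disks around the points of a finite set \<open>F\<close>, all defects involved are comparable. Hence
  the disjoint Euclidean disks around the points of \<open>F\<close> contain disks of a common radius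
  proportional to \<open>1 - |w|\<^sup>2\<close>, and they lie in a disk around \<open>w\<close> of radius of the same order. Comparing
  areas bounds the cardinality of \<open>F\<close>.\<close>

lemma separated_bounded_overlap:
  assumes S: "separated r S" and r: "0 < r" "r < 1" and R: "0 < R" "R < 1"
  obtains M :: nat where "M > 0"
    "\<And>w. w \<in> \<bbbD> \<Longrightarrow> finite {z\<in>S. w \<in> pseudohyperbolic_disk z R}"
    "\<And>w. w \<in> \<bbbD> \<Longrightarrow> card {z\<in>S. w \<in> pseudohyperbolic_disk z R} \<le> M"
proof -
  have R2: "0 < 1 - R\<^sup>2" "1 - R\<^sup>2 \<le> 1" using R by (auto simp: power_less_one_iff)
  define k where "k = (1 - R\<^sup>2) / 4"
  define C where "C = 2 / (1 - R\<^sup>2) + 1"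
  have k: "0 < k" using R2 by (simp add: k_def)
  have "1 - R\<^sup>2 = 4 * k" by (simp add: k_def)
  with R2 have k1: "k \<le> 1" by simp
  have C: "C > 0" using R2 by (simp add: C_def add_pos_pos)
  define M where "M = nat \<lceil>(4 * C / (r * k))\<^sup>2\<rceil> + 1"
  have bound: "card F \<le> M" if w: "w \<in> \<bbbD>" and F: "finite F" "F \<subseteq> {z\<in>S. w \<in> pseudohyperbolic_disk z R}" for w F
  proof -
    let ?d = "1 - (cmod w)\<^sup>2"
    have d: "?d > 0" using defect_pos[of w] w by simp
    define \<rho> where "\<rho> = r * k / 4 * ?d"
    have \<rho>: "\<rho> > 0" using r k d by (simp add: \<rho>_def)
    have z: "k * ?d \<le> 1 - (cmod z)\<^sup>2" "cmod (z - w) \<le> 2 / (1 - R\<^sup>2) * ?d" if "z \<in> F" for z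
    proof -
      have zD: "cmod z < 1" and zw: "w \<in> pseudohyperbolic_disk z R"
        using that F S by (auto simp: separated_def)
      have "k * ?d \<le> k * (2 * cmod (1 - cnj z * w))"
        using norm_one_minus_cnj_mult_ge(2)[OF zD, of w] w k by (intro mult_left_mono) auto
      also have "\<dots> \<le> 1 - (cmod z)\<^sup>2"
        using defect_comparable(1)[OF zD zw R] by (simp add: k_def)
      finally show "k * ?d \<le> 1 - (cmod z)\<^sup>2" .
      have "cmod (z - w) \<le> 1 * cmod (1 - cnj z * w)"
        using zw zD R mem_pseudohyperbolic_disk[of z w R] mult_right_mono[of R 1 "cmod (1 - cnj z * w)"] by auto
      also have "\<dots> \<le> 2 / (1 - R\<^sup>2) * ?d"
        using defect_comparable(2)[OF zD zw R] R2 by (simp add: field_simps)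
      finally show "cmod (z - w) \<le> 2 / (1 - R\<^sup>2) * ?d" .
    qed
    have sub: "ball z \<rho> \<subseteq> ball z (r / 4 * (1 - (cmod z)\<^sup>2))" if "z \<in> F" for z
      using mult_left_mono[OF z(1)[OF that], of "r / 4"] r by (intro subset_ball) (simp add: \<rho>_def ac_simps)
    have disj: "disjoint_family_on (\<lambda>z. ball z \<rho>) F"
      unfolding disjoint_family_on_def using sub disjoint_balls_if_separated[OF S r(1)] F by blast
    have "\<rho> \<le> 1 * ?d"
      unfolding \<rho>_def using r k k1 d mult_mono[of r 1 k 1] by (intro mult_right_mono) auto
    have "(\<Union>z\<in>F. ball z \<rho>) \<subseteq> ball w (C * ?d)"
    proof clarify
      fix z u assume "z \<in> F" "u \<in> ball z \<rho>"
      then have "dist w u < 2 / (1 - R\<^sup>2) * ?d + 1 * ?d"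
        using z(2)[of z] \<open>\<rho> \<le> 1 * ?d\<close> dist_triangle[of w u z]
        by (simp add: dist_norm norm_minus_commute)
      then show "u \<in> ball w (C * ?d)" by (simp add: C_def distrib_right)
    qed
    then have "emeasure lborel (\<Union>z\<in>F. ball z \<rho>) \<le> emeasure lborel (ball w (C * ?d))"
      by (intro emeasure_mono) auto
    moreover have "emeasure lborel (\<Union>z\<in>F. ball z \<rho>) = (\<Sum>z\<in>F. emeasure lborel (ball z \<rho>))"
      using disj F by (intro sum_emeasure[symmetric]) auto
    ultimately have "ennreal (real (card F) * (pi * \<rho>\<^sup>2)) \<le> ennreal (pi * (C * ?d)\<^sup>2)"
      using \<rho> C d by (simp add: emeasure_lborel_ball_complex ennreal_mult' flip: ennreal_of_nat_eq_real_of_nat)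
    then have "real (card F) * (pi * \<rho>\<^sup>2) \<le> pi * (C * ?d)\<^sup>2"
      by (subst (asm) ennreal_le_iff) auto
    then have "real (card F) * \<rho>\<^sup>2 \<le> (C * ?d)\<^sup>2"
      using pi_gt_zero by (simp add: algebra_simps)
    then have "real (card F) \<le> (C * ?d)\<^sup>2 / \<rho>\<^sup>2"
      using \<rho> by (simp add: pos_le_divide_eq)
    also have "\<dots> = (4 * C / (r * k))\<^sup>2"
      using d r k by (simp add: \<rho>_def power_divide power_mult_distrib)
    finally show ?thesis
      unfolding M_def by linarith
  qed
  have "finite {z\<in>S. w \<in> pseudohyperbolic_disk z R} \<and> card {z\<in>S. w \<in> pseudohyperbolic_disk z R} \<le> M"
    if "w \<in> \<bbbD>" for w
    using bound[OF that] by (intro finite_if_finite_subsets_card_bdd) auto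
  then show ?thesis by (intro that[of M]) (auto simp: M_def)
qed

lemma ex_r_lattice:
  assumes r: "0 < r" "r < 1"
  obtains z where "r_lattice r z"
proof -
  obtain S where S: "separated r S" and cover: "\<And>w. w \<in> \<bbbD> \<Longrightarrow> \<exists>z\<in>S. w \<in> pseudohyperbolic_disk z r"
    using ex_separated_cover[OF r] by blast
  have R: "0 < (1 + r) / 2" "(1 + r) / 2 < 1" using r by auto
  obtain M where M: "M > 0"
    "\<And>w. w \<in> \<bbbD> \<Longrightarrow> finite {z\<in>S. w \<in> pseudohyperbolic_disk z ((1 + r) / 2)}"
    "\<And>w. w \<in> \<bbbD> \<Longrightarrow> card {z\<in>S. w \<in> pseudohyperbolic_disk z ((1 + r) / 2)} \<le> M"
    using separated_bounded_overlap[OF S r R] by blast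
  have SD: "S \<subseteq> \<bbbD>" using S by (simp add: separated_def)
  have "infinite S" using infinite_if_pseudohyperbolic_cover[OF SD r cover] .
  then obtain e :: "nat \<Rightarrow> complex" where bij: "bij_betw e UNIV S"
    using countable_separated[OF S r(1)] bij_betw_from_nat_into by blast
  then have rng: "range (e) = S" and inj: "inj (e)"
    by (auto simp: bij_betw_def)
  have eq: "{k. w \<in> pseudohyperbolic_disk (e k) R} =
      e -` {z\<in>S. w \<in> pseudohyperbolic_disk z R}" for w R
    using rng by auto
  have "r_lattice r (e)"
    unfolding r_lattice_def
  proof (intro conjI exI[of _ M] ballI)
    show "range (e) \<subseteq> \<bbbD>" using rng SD by simp
    show "\<bbbD> = (\<Union>k. pseudohyperbolic_disk (e k) r)"
    proof
      show "\<bbbD> \<subseteq> (\<Union>k. pseudohyperbolic_disk (e k) r)"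
      proof
        fix w assume "w \<in> \<bbbD>"
        then obtain z where "z \<in> S" "w \<in> pseudohyperbolic_disk z r" using cover by blast
        then show "w \<in> (\<Union>k. pseudohyperbolic_disk (e k) r)"
          using rng by blast
      qed
    qed (auto simp: pseudohyperbolic_disk_def)
  next
    fix w assume w: "w \<in> \<bbbD>"
    show "finite {k. w \<in> pseudohyperbolic_disk (e k) ((1 + r) / 2)}"
      unfolding eq by (intro finite_vimageI M w inj)
    show "card {k. w \<in> pseudohyperbolic_disk (e k) ((1 + r) / 2)} \<le> M"
      unfolding eq by (subst card_vimage_inj[OF inj]) (use rng M(3)[OF w] in auto)
  qed (use M in auto)
  then show ?thesis by (rule that)
qed

lemma norm_r_lattice: "r_lattice r z \<Longrightarrow> cmod (z k) < 1"
  unfolding r_lattice_def by (metis mem_ball_0 rangeI subsetD)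

text \<open>Every point lies in at most \<open>M\<close> of the enlarged disks, so the sum of their indicators is at most
  \<open>M\<close> times the indicator of the unit disk.\<close>

lemma r_lattice_sum_le:
  assumes "r_lattice r z"
  obtains M :: nat where "\<And>g :: complex \<Rightarrow> ennreal. (\<lambda>u. g u * indicator \<bbbD> u) \<in> borel_measurable borel \<Longrightarrow>
    (\<Sum>k. \<integral>\<^sup>+u. g u * indicator (pseudohyperbolic_disk (z k) ((1 + r) / 2)) u \<partial>lborel) \<le>
    of_nat M * (\<integral>\<^sup>+u. g u * indicator \<bbbD> u \<partial>lborel)"
proof -
  let ?E = "\<lambda>k. pseudohyperbolic_disk (z k) ((1 + r) / 2)"
  obtain M :: nat where M: "\<And>w. w \<in> \<bbbD> \<Longrightarrow> finite {k. w \<in> ?E k}" "\<And>w. w \<in> \<bbbD> \<Longrightarrow> card {k. w \<in> ?E k} \<le> M"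
    using assms unfolding r_lattice_def by metis
  have zD: "cmod (z k) < 1" for k using norm_r_lattice[OF assms] .
  have ED: "?E k \<subseteq> \<bbbD>" for k by (auto simp: pseudohyperbolic_disk_def)
  show ?thesis
  proof (rule that[of M])
    fix g :: "complex \<Rightarrow> ennreal"
    assume g: "(\<lambda>u. g u * indicator \<bbbD> u) \<in> borel_measurable borel"
    have eq: "g u * indicator (?E k) u = (g u * indicator \<bbbD> u) * indicator (?E k) u" for u k
      using ED[of k] by (auto simp: indicator_def)
    have "(\<Sum>k. \<integral>\<^sup>+u. g u * indicator (?E k) u \<partial>lborel) = (\<integral>\<^sup>+u. (\<Sum>k. g u * indicator (?E k) u) \<partial>lborel)"
      unfolding eq using open_pseudohyperbolic_disk[OF zD]
      by (intro nn_integral_suminf[symmetric])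
        (auto intro!: borel_measurable_times_ennreal borel_measurable_indicator g)
    also have "\<dots> \<le> (\<integral>\<^sup>+u. of_nat M * (g u * indicator \<bbbD> u) \<partial>lborel)"
    proof (rule nn_integral_mono)
      fix u :: complex
      show "(\<Sum>k. g u * indicator (?E k) u) \<le> of_nat M * (g u * indicator \<bbbD> u)"
      proof (cases "u \<in> \<bbbD>")
        case True
        have "(\<Sum>k. g u * indicator (?E k) u) = (\<Sum>k\<in>{k. u \<in> ?E k}. g u * indicator (?E k) u)"
          by (intro suminf_finite M True) auto
        also have "\<dots> = of_nat (card {k. u \<in> ?E k}) * g u"
          by simp
        also have "\<dots> \<le> of_nat M * g u"
          by (intro mult_right_mono of_nat_mono M True) auto
        finally show ?thesis using True by simp
      next
        case False
        then have "indicator (?E k) u = (0 :: ennreal)" for k using ED[of k] by (auto simp: indicator_def)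
        then show ?thesis by simp
      qed
    qed
    also have "\<dots> = of_nat M * (\<integral>\<^sup>+u. g u * indicator \<bbbD> u \<partial>lborel)"
      using g by (intro nn_integral_cmult) simp
    finally show "(\<Sum>k. \<integral>\<^sup>+u. g u * indicator (?E k) u \<partial>lborel) \<le>
        of_nat M * (\<integral>\<^sup>+u. g u * indicator \<bbbD> u \<partial>lborel)" .
  qed
qed

section \<open>Weights, measures and the two quotients\<close>

text \<open>Compactness of \<open>[0, 1]\<close>. This is where positivity of the weight at the end point \<open>1\<close> enters.\<close>

lemma weight_bounds:
  assumes "weight \<sigma>"
  obtains m M where "0 < m" "\<And>z. cmod z < 1 \<Longrightarrow> m \<le> \<sigma> (cmod z)" "\<And>z. cmod z < 1 \<Longrightarrow> \<sigma> (cmod z) \<le> M"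
    "(\<lambda>z. \<sigma> (cmod z)) \<in> borel_measurable (restrict_space borel \<bbbD>)"
proof -
  have cont: "continuous_on {0..1} \<sigma>"
    using assms unfolding weight_def C2_unit_interval_def
    by (meson DERIV_continuous_on)
  then have "continuous_on \<bbbD> (\<lambda>z. \<sigma> (cmod z))"
    by (rule continuous_on_compose2) (auto intro!: continuous_intros)
  then have meas: "(\<lambda>z. \<sigma> (cmod z)) \<in> borel_measurable (restrict_space borel \<bbbD>)"
    by (rule borel_measurable_continuous_on_restrict)
  obtain a b where a: "a \<in> {0..1}" "\<forall>x\<in>{0..1}. \<sigma> a \<le> \<sigma> x" and b: "\<forall>x\<in>{0..1}. \<sigma> x \<le> \<sigma> b"
    using continuous_attains_inf[of "{0..1::real}" \<sigma>] continuous_attains_sup[of "{0..1::real}" \<sigma>] cont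
    by auto
  have "0 < \<sigma> a" using assms a by (auto simp: weight_def)
  with a b meas show ?thesis by (intro that[of "\<sigma> a" "\<sigma> b"]) auto
qed

lemma disk_measures_simps:
  assumes "\<Omega> \<in> disk_measures"
  shows "space \<Omega> = \<bbbD>" "finite_measure \<Omega>" "\<And>A. A \<subseteq> \<bbbD> \<Longrightarrow> A \<in> sets borel \<Longrightarrow> A \<in> sets \<Omega>"
    "\<And>f :: complex \<Rightarrow> 'b :: topological_space. continuous_on \<bbbD> f \<Longrightarrow> f \<in> borel_measurable \<Omega>"
proof -
  have S: "sets \<Omega> = sets (restrict_space borel \<bbbD>)" and F: "finite_measure \<Omega>"
    using assms by (auto simp: disk_measures_def)
  show "space \<Omega> = \<bbbD>" using sets_eq_imp_space_eq[OF S] by (simp add: space_restrict_space)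
  show "finite_measure \<Omega>" by fact
  show "A \<in> sets \<Omega>" if "A \<subseteq> \<bbbD>" "A \<in> sets borel" for A
    unfolding S using that by (auto simp: sets_restrict_space)
  show "f \<in> borel_measurable \<Omega>" if "continuous_on \<bbbD> f" for f :: "complex \<Rightarrow> 'b"
    using borel_measurable_continuous_on_restrict[OF that] by (simp add: measurable_cong_sets[OF S refl])
qed

lemma pseudohyperbolic_disk_in_sets:
  assumes "\<Omega> \<in> disk_measures" "cmod a < 1"
  shows "pseudohyperbolic_disk a r \<in> sets \<Omega>"
  using open_pseudohyperbolic_disk[OF assms(2)]
  by (intro disk_measures_simps(3)[OF assms(1)]) (auto simp: pseudohyperbolic_disk_def)

text \<open>For a real exponent the modulus of a complex power depends on the modulus of its base only, so no
  branch of the power matters.\<close>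

lemma norm_normalized_kernel:
  assumes "cmod z < 1"
  shows "cmod (normalized_kernel \<alpha> z w) =
    cmod (1 - cnj z * w) powr - (\<alpha> + 2) * (1 - (cmod z)\<^sup>2) powr ((\<alpha> + 2) / 2)"
proof -
  let ?d = "1 - (cmod z)\<^sup>2"
  have d: "?d > 0" using defect_pos[OF assms] .
  have k: "cmod (Bergman_kernel \<alpha> x y) = cmod (1 - cnj y * x) powr - (\<alpha> + 2)" for x y
    unfolding Bergman_kernel_def by (subst norm_powr_real_powr') auto
  have "1 - cnj z * z = of_real ?d"
    by (simp add: complex_norm_square mult.commute del: of_real_power)
  then have "cmod (1 - cnj z * z) = ?d"
    using d by (simp only: norm_of_real abs_of_pos)
  then have n: "cmod (csqrt (Bergman_kernel \<alpha> z z)) = ?d powr (- ((\<alpha> + 2) / 2))"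
    using d by (simp add: norm_csqrt k powr_half_sqrt[symmetric] powr_powr minus_divide_left)
  show ?thesis
    unfolding normalized_kernel_def norm_divide n k norm_one_minus_cnj_mult_commute[of w z]
    by (simp only: powr_minus divide_inverse inverse_inverse_eq)
qed

text \<open>Rewrites the Bochner integral as a nonnegative integral, which is harmless since the kernel is
  bounded for fixed \<open>z\<close> and \<open>\<Omega>\<close> is finite, and collects the powers of the defect.\<close>

lemma Berezin_quotient_eq:
  assumes \<Omega>: "\<Omega> \<in> disk_measures" and z: "cmod z < 1" and s: "(\<alpha> + 2) * t > 0"
  shows "ennreal (Berezin_quotient p q \<sigma> \<alpha> t \<Omega> z) =
    ennreal ((1 - (cmod z)\<^sup>2) powr ((\<alpha> + 2) * t - 2 * q / p) / \<sigma> (cmod z) powr (q / p)) *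
    (\<integral>\<^sup>+w. ennreal (cmod (1 - cnj z * w) powr - ((\<alpha> + 2) * t)) \<partial>\<Omega>)"
proof -
  interpret finite_measure \<Omega> using disk_measures_simps(2)[OF \<Omega>] .
  let ?d = "1 - (cmod z)\<^sup>2" and ?s = "(\<alpha> + 2) * t"
  let ?g = "\<lambda>w. cmod (1 - cnj z * w) powr - ?s"
  have d: "?d > 0" using defect_pos[OF z] .
  have g: "?g w \<le> (?d / 2) powr - ?s" if "w \<in> \<bbbD>" for w
    using norm_one_minus_cnj_mult_ge(1)[OF z, of w] that d s by (intro powr_mono2') auto
  have ne: "cmod (1 - cnj z * w) \<noteq> 0" if "w \<in> \<bbbD>" for w
    using norm_one_minus_cnj_mult_ge(3)[OF z, of w] that by auto
  have "?g \<in> borel_measurable \<Omega>"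
    using ne by (intro disk_measures_simps(4)[OF \<Omega>] continuous_on_powr continuous_intros) auto
  then have int: "integrable \<Omega> ?g"
    using g by (intro integrable_const_bound[of _ "(?d / 2) powr - ?s"])
      (auto simp: disk_measures_simps(1)[OF \<Omega>] intro!: AE_I2)
  have "Berezin \<alpha> t \<Omega> z = (\<integral>w. ?d powr (?s / 2) * ?g w \<partial>\<Omega>)"
    unfolding Berezin_def norm_normalized_kernel[OF z]
    by (simp add: powr_mult powr_powr algebra_simps)
  also have "\<dots> = ?d powr (?s / 2) * (\<integral>w. ?g w \<partial>\<Omega>)" by simp
  finally have B: "Berezin \<alpha> t \<Omega> z = ?d powr (?s / 2) * (\<integral>w. ?g w \<partial>\<Omega>)" .
  have "Berezin_quotient p q \<sigma> \<alpha> t \<Omega> z =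
      ?d powr (?s - 2 * q / p) / \<sigma> (cmod z) powr (q / p) * (\<integral>w. ?g w \<partial>\<Omega>)"
  proof -
    have "?d powr (?s - 2 * q / p) = ?d powr (?s / 2) / ?d powr (2 * q / p - ?s / 2)"
      unfolding powr_diff[symmetric] by (simp add: algebra_simps)
    then show ?thesis
      unfolding Berezin_quotient_def B by simp
  qed
  moreover have "(\<integral>\<^sup>+w. ennreal (?g w) \<partial>\<Omega>) = ennreal (\<integral>w. ?g w \<partial>\<Omega>)"
    by (intro nn_integral_eq_integral int) simp
  ultimately show ?thesis
    by (simp only:) (intro ennreal_mult; simp)
qed

lemma Berezin_quotient_nonneg: "0 \<le> Berezin_quotient p q \<sigma> \<alpha> t \<Omega> z"
  by (simp add: Berezin_quotient_def Berezin_def)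

lemma averaging_quotient_nonneg: "0 \<le> averaging_quotient p q \<sigma> r \<Omega> z"
  by (simp add: averaging_quotient_def averaging_def)

section \<open>Averages are dominated by the Berezin transform\<close>

text \<open>On \<open>E(z, r)\<close> the integrand of the Berezin transform is at least a constant times
  \<open>(1 - |z|\<^sup>2) powr (-s)\<close>, so its integral over that disk already dominates the average.\<close>

lemma averaging_quotient_le_Berezin_quotient:
  fixes p q \<alpha> t :: real
  assumes r: "0 < r" "r < 1" and \<sigma>: "\<And>z. cmod z < 1 \<Longrightarrow> 0 < \<sigma> (cmod z)" and p: "p > 0" and s: "(\<alpha> + 2) * t > 0"
  shows "\<exists>C>0. \<forall>\<Omega>\<in>disk_measures. \<forall>z\<in>\<bbbD>. ennreal (averaging_quotient p q \<sigma> r \<Omega> z) \<le>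
    ennreal C * ennreal (Berezin_quotient p q \<sigma> \<alpha> t \<Omega> z)"
proof -
  let ?s = "(\<alpha> + 2) * t"
  have r2: "1 - r\<^sup>2 > 0" using r by (simp add: power_less_one_iff)
  define k where "k = (2 / (1 - r\<^sup>2)) powr - ?s"
  have k: "k > 0" using r2 by (simp add: k_def)
  have "ennreal (averaging_quotient p q \<sigma> r \<Omega> z) \<le>
      ennreal ((4 / r)\<^sup>2 / k) * ennreal (Berezin_quotient p q \<sigma> \<alpha> t \<Omega> z)"
    if \<Omega>: "\<Omega> \<in> disk_measures" and zD: "z \<in> \<bbbD>" for \<Omega> z
  proof -
    interpret finite_measure \<Omega> using disk_measures_simps(2)[OF \<Omega>] .
    let ?d = "1 - (cmod z)\<^sup>2" and ?E = "pseudohyperbolic_disk z r" and ?S = "\<sigma> (cmod z) powr (q / p)"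
    have z: "cmod z < 1" using zD by simp
    have d: "?d > 0" using defect_pos[OF z] .
    have S: "?S > 0" using \<sigma>[OF z] by simp
    have "k * ?d powr - ?s \<le> cmod (1 - cnj z * w) powr - ?s" if "w \<in> ?E" for w
    proof -
      have "cmod (1 - cnj z * w) \<le> 2 / (1 - r\<^sup>2) * ?d"
        using defect_comparable(1)[OF z that r] r2 by (simp add: field_simps)
      moreover have "cmod (1 - cnj z * w) > 0"
        using norm_one_minus_cnj_mult_ge(3)[OF z, of w] that by (simp add: pseudohyperbolic_disk_def)
      ultimately have "(2 / (1 - r\<^sup>2) * ?d) powr - ?s \<le> cmod (1 - cnj z * w) powr - ?s"
        using s by (intro powr_mono2') auto
      then show ?thesis using d r2 by (simp only: k_def powr_mult)
    qed
    then have "(\<integral>\<^sup>+w. ennreal (k * ?d powr - ?s) * indicator ?E w \<partial>\<Omega>) \<le>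
        (\<integral>\<^sup>+w. ennreal (cmod (1 - cnj z * w) powr - ?s) \<partial>\<Omega>)"
      by (intro nn_integral_mono) (auto simp: indicator_def intro!: ennreal_leI)
    then have 1: "ennreal (k * ?d powr - ?s * measure \<Omega> ?E) \<le>
        (\<integral>\<^sup>+w. ennreal (cmod (1 - cnj z * w) powr - ?s) \<partial>\<Omega>)"
      using pseudohyperbolic_disk_in_sets[OF \<Omega> z] k
      by (simp add: nn_integral_cmult_indicator emeasure_eq_measure ennreal_mult')
    have area: "measure disk_area ?E \<ge> (r / 4)\<^sup>2 * ?d\<^sup>2" "(r / 4)\<^sup>2 * ?d\<^sup>2 > 0"
      using measure_pseudohyperbolic_disk(1)[OF z r] d r by auto
    have e: "?d powr (2 * (q - p) / p) = ?d powr (2 * q / p) / ?d\<^sup>2"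
      using d p by (simp add: diff_divide_distrib right_diff_distrib powr_diff)
    have "averaging_quotient p q \<sigma> r \<Omega> z =
        measure \<Omega> ?E / measure disk_area ?E / (?S * ?d powr (2 * (q - p) / p))"
      by (simp add: averaging_quotient_def averaging_def)
    also have "\<dots> \<le> measure \<Omega> ?E / ((r / 4)\<^sup>2 * ?d\<^sup>2) / (?S * ?d powr (2 * (q - p) / p))"
      using area S by (intro divide_right_mono divide_left_mono mult_pos_pos) auto
    also have "\<dots> = (4 / r)\<^sup>2 / k * (?d powr (?s - 2 * q / p) / ?S * (k * ?d powr - ?s * measure \<Omega> ?E))"
    proof -
      have "measure \<Omega> ?E / ((r / 4)\<^sup>2 * ?d\<^sup>2) / (?S * (?d powr (2 * q / p) / ?d\<^sup>2)) =
        (4 / r)\<^sup>2 / k * (?d powr (s' - 2 * q / p) / ?S * (k * ?d powr - s' * measure \<Omega> ?E))" for s'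
        using d r k S by (simp add: powr_diff powr_minus field_simps)
      then show ?thesis unfolding e .
    qed
    finally have "ennreal (averaging_quotient p q \<sigma> r \<Omega> z) \<le>
        ennreal ((4 / r)\<^sup>2 / k * (?d powr (?s - 2 * q / p) / ?S * (k * ?d powr - ?s * measure \<Omega> ?E)))"
      by (rule ennreal_leI)
    also have "\<dots> = ennreal ((4 / r)\<^sup>2 / k) *
        (ennreal (?d powr (?s - 2 * q / p) / ?S) * ennreal (k * ?d powr - ?s * measure \<Omega> ?E))"
      using k S by (intro ennreal_mult3) auto
    also have "\<dots> \<le> ennreal ((4 / r)\<^sup>2 / k) * ennreal (Berezin_quotient p q \<sigma> \<alpha> t \<Omega> z)"
      unfolding Berezin_quotient_eq[OF \<Omega> z s] by (intro mult_left_mono 1) auto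
    finally show ?thesis .
  qed
  then show ?thesis using k r by (intro exI[of _ "(4 / r)\<^sup>2 / k"]) auto
qed

section \<open>The Berezin transform is dominated by the embedding\<close>

text \<open>The test functions are the powers of the kernel whose \<open>q\<close>-th power is the integrand of the Berezin
  transform, normalized by the Forelli-Rudin estimate. Up to constants the normalization produces
  exactly the power of the defect in the Berezin quotient. The same function serves all measures, so the
  constant is uniform in \<open>\<Omega>\<close>.\<close>

lemma Bergman_test_function:
  fixes p q \<alpha> t M :: real
  assumes \<sigma>: "0 < m" "\<And>z. cmod z < 1 \<Longrightarrow> m \<le> \<sigma> (cmod z)" "\<And>z. cmod z < 1 \<Longrightarrow> \<sigma> (cmod z) \<le> M"
    and \<sigma>m: "(\<lambda>z. \<sigma> (cmod z)) \<in> borel_measurable (restrict_space borel \<bbbD>)"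
    and p: "p > 0" and q: "q > 0" and s: "(\<alpha> + 2) * t > 2 * q / p"
  shows "\<exists>C>0. \<forall>z\<in>\<bbbD>. \<exists>f\<in>Bergman_space p \<sigma>. Bergman_norm p \<sigma> f \<le> 1 \<and>
    (\<forall>\<Omega>\<in>disk_measures. ennreal (Berezin_quotient p q \<sigma> \<alpha> t \<Omega> z) \<le>
       ennreal C * (\<integral>\<^sup>+w. ennreal (cmod (f w) powr q) \<partial>\<Omega>))"
proof -
  define s where "s = (\<alpha> + 2) * t"
  define \<gamma> where "\<gamma> = s * p / q"
  have s0: "s > 2 * q / p" "s > 0" using s p q by (auto simp: s_def intro: less_trans[rotated])
  have \<gamma>: "\<gamma> > 2" using s0 p q by (simp add: \<gamma>_def field_simps)
  define K where "K = M / pi * (16 * pi / (1 - 2 powr (2 - \<gamma>)) * 2 powr (\<gamma> - 2))"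
  have M: "M > 0" using \<sigma>(1) \<sigma>(2,3)[of 0] by simp
  have K: "K > 0" using M \<gamma> by (simp add: K_def powr_less_one)
  define C where "C = K powr (q / p) / m powr (q / p)"
  have C: "C > 0" using K \<sigma>(1) by (simp add: C_def)
  have "\<exists>f\<in>Bergman_space p \<sigma>. Bergman_norm p \<sigma> f \<le> 1 \<and>
    (\<forall>\<Omega>\<in>disk_measures. ennreal (Berezin_quotient p q \<sigma> \<alpha> t \<Omega> z) \<le>
       ennreal C * (\<integral>\<^sup>+w. ennreal (cmod (f w) powr q) \<partial>\<Omega>))" if zD: "z \<in> \<bbbD>" for z
  proof -
    let ?d = "1 - (cmod z)\<^sup>2"
    have z: "cmod z < 1" using zD by simp
    have d: "?d > 0" using defect_pos[OF z] .
    \<comment> \<open>By the Forelli-Rudin estimate \<open>K * ?d powr (2 - \<gamma>)\<close> bounds the weighted integral of the \<open>p\<close>-th power before scaling.\<close>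
    define A where "A = (K * ?d powr (2 - \<gamma>)) powr (- 1 / p)"
    have A: "A > 0" using K d by (simp add: A_def)
    define f where "f w = of_real A * (1 - cnj z * w) powr of_real (- s / q)" for w
    have re: "Re (1 - cnj z * w) > 0" if "w \<in> \<bbbD>" for w
    proof -
      have "cmod (cnj z * w) < 1"
        unfolding norm_mult complex_mod_cnj using mult_strict_mono'[of "cmod z" 1 "cmod w" 1] z that by simp
      then show ?thesis using complex_Re_le_cmod[of "cnj z * w"] by simp
    qed
    have nn: "1 - cnj z * w \<notin> \<real>\<^sub>\<le>\<^sub>0" if "w \<in> \<bbbD>" for w
      using re[OF that] by (metis complex_nonpos_Reals_iff not_less)
    have hol: "f holomorphic_on \<bbbD>"
      unfolding f_def by (intro holomorphic_intros nn)
    have nf: "cmod (f w) = A * cmod (1 - cnj z * w) powr (- s / q)" for w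
      unfolding f_def using A by (simp add: norm_mult norm_powr_real_powr')
    have cont: "continuous_on \<bbbD> (\<lambda>w. cmod (1 - cnj z * w) powr e)" for e
    proof (intro continuous_on_powr continuous_intros)
      show "\<forall>w\<in>\<bbbD>. cmod (1 - cnj z * w) \<noteq> 0" using re by fastforce
    qed
    have fp: "cmod (f w) powr p = A powr p * cmod (1 - cnj z * w) powr - \<gamma>" for w
      unfolding nf using A by (simp add: powr_mult powr_powr \<gamma>_def)
    have fq: "cmod (f w) powr q = A powr q * cmod (1 - cnj z * w) powr - s" for w
      unfolding nf using A q by (simp add: powr_mult powr_powr)
    have Ap: "A powr p * (K * ?d powr (2 - \<gamma>)) = 1"
    proof -
      have "A powr p = (K * ?d powr (2 - \<gamma>)) powr - 1"
        unfolding A_def powr_powr using p by simp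
      moreover have "Y powr - 1 * Y = 1" if "Y > 0" for Y :: real
        using that by (simp add: powr_minus)
      moreover have "K * ?d powr (2 - \<gamma>) > 0" using K d by simp
      ultimately show ?thesis by metis
    qed
    have "A powr q = (K * ?d powr (2 - \<gamma>)) powr (- (q / p))"
      by (simp add: A_def powr_powr)
    also have "\<dots> = K powr (- (q / p)) * ?d powr ((2 - \<gamma>) * - (q / p))"
      using K d by (simp add: powr_mult powr_powr)
    also have "(2 - \<gamma>) * - (q / p) = s - 2 * q / p"
      using p q by (simp add: \<gamma>_def field_simps)
    finally have Aq: "A powr q = ?d powr (s - 2 * q / p) / K powr (q / p)"
      by (simp add: powr_minus divide_inverse)

    have "(\<integral>\<^sup>+w. ennreal (cmod (f w) powr p * \<sigma> (cmod w)) \<partial>disk_area) =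
        ennreal (1 / pi) * (\<integral>\<^sup>+w. ennreal (cmod (f w) powr p * \<sigma> (cmod w)) * indicator \<bbbD> w \<partial>lborel)"
      unfolding fp
      by (intro nn_integral_disk_area measurable_compose[OF _ measurable_ennreal]
          borel_measurable_times \<sigma>m borel_measurable_const
          borel_measurable_continuous_on_restrict cont)
    also have "\<dots> \<le> ennreal (1 / pi) * (\<integral>\<^sup>+w. ennreal (A powr p * M) *
        (ennreal (cmod (1 - cnj z * w) powr - \<gamma>) * indicator \<bbbD> w) \<partial>lborel)"
    proof (intro mult_left_mono nn_integral_mono)
      fix w :: complex
      show "ennreal (cmod (f w) powr p * \<sigma> (cmod w)) * indicator \<bbbD> w \<le>
          ennreal (A powr p * M) * (ennreal (cmod (1 - cnj z * w) powr - \<gamma>) * indicator \<bbbD> w)"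
      proof (cases "w \<in> \<bbbD>")
        case True
        have "cmod (f w) powr p * \<sigma> (cmod w) \<le> A powr p * M * cmod (1 - cnj z * w) powr - \<gamma>"
          unfolding fp using mult_left_mono[OF \<sigma>(3)[of w], of "A powr p * cmod (1 - cnj z * w) powr - \<gamma>"] True
          by (simp add: ac_simps)
        then have "ennreal (cmod (f w) powr p * \<sigma> (cmod w)) \<le>
            ennreal (A powr p * M * cmod (1 - cnj z * w) powr - \<gamma>)"
          by (rule ennreal_leI)
        also have "\<dots> = ennreal (A powr p * M) * ennreal (cmod (1 - cnj z * w) powr - \<gamma>)"
          by (rule ennreal_mult'') simp
        finally show ?thesis using True by simp
      qed simp
    qed simp
    also have "\<dots> = ennreal (1 / pi) * (ennreal (A powr p * M) *
        (\<integral>\<^sup>+w. ennreal (cmod (1 - cnj z * w) powr - \<gamma>) * indicator \<bbbD> w \<partial>lborel))"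
    proof -
      have "(\<lambda>w. if w \<in> \<bbbD> then ennreal (cmod (1 - cnj z * w) powr - \<gamma>) else 0) \<in> borel_measurable borel"
        by (intro borel_measurable_continuous_on_if continuous_on_ennreal cont continuous_on_const) auto
      then have "(\<lambda>w. ennreal (cmod (1 - cnj z * w) powr - \<gamma>) * indicator \<bbbD> w) \<in> borel_measurable lborel"
        by (simp add: indicator_def if_distrib cong: if_cong)
      then show ?thesis by (subst nn_integral_cmult) auto
    qed
    also have "\<dots> \<le> ennreal (1 / pi) * (ennreal (A powr p * M) *
        ennreal (16 * pi / (1 - 2 powr (2 - \<gamma>)) * 2 powr (\<gamma> - 2) * ?d powr (2 - \<gamma>)))"
      by (intro mult_left_mono Forelli_Rudin_estimate \<gamma> z) auto
    also have "\<dots> = ennreal (1 / pi * (A powr p * M *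
        (16 * pi / (1 - 2 powr (2 - \<gamma>)) * 2 powr (\<gamma> - 2) * ?d powr (2 - \<gamma>))))"
      using M \<gamma> by (intro ennreal_mult3[symmetric]) (auto simp: powr_less_one less_imp_le)
    also have "1 / pi * (A powr p * M *
        (16 * pi / (1 - 2 powr (2 - \<gamma>)) * 2 powr (\<gamma> - 2) * ?d powr (2 - \<gamma>))) = A powr p * (K * ?d powr (2 - \<gamma>))"
      by (simp add: K_def)
    finally have N: "(\<integral>\<^sup>+w. ennreal (cmod (f w) powr p * \<sigma> (cmod w)) \<partial>disk_area) \<le> 1"
      unfolding Ap by simp
    have B1: "Bergman_norm p \<sigma> f \<le> 1"
      using epowr_mono[OF N, of "1 / p"] p epowr_simps(1)[of 1 "1 / p"]
      unfolding Bergman_norm_def by simp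
    then have "Bergman_norm p \<sigma> f < \<infinity>"
      by (rule order.strict_trans1) simp
    with hol have mem: "f \<in> Bergman_space p \<sigma>" by (simp add: Bergman_space_def)
    have "ennreal (Berezin_quotient p q \<sigma> \<alpha> t \<Omega> z) \<le>
       ennreal C * (\<integral>\<^sup>+w. ennreal (cmod (f w) powr q) \<partial>\<Omega>)" if \<Omega>: "\<Omega> \<in> disk_measures" for \<Omega>
    proof -
      let ?I = "\<integral>\<^sup>+w. ennreal (cmod (1 - cnj z * w) powr - s) \<partial>\<Omega>"
      have "m powr (q / p) \<le> \<sigma> (cmod z) powr (q / p)"
        using \<sigma>(1) \<sigma>(2)[OF z] p q by (intro powr_mono2) auto
      then have "?d powr (s - 2 * q / p) / \<sigma> (cmod z) powr (q / p) \<le> C * A powr q"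
        unfolding Aq C_def using K \<sigma>(1) \<sigma>(2)[OF z] by (simp add: divide_left_mono)
      then have "ennreal (?d powr (s - 2 * q / p) / \<sigma> (cmod z) powr (q / p)) * ?I \<le> ennreal (C * A powr q) * ?I"
        by (intro mult_right_mono ennreal_leI) auto
      also have "\<dots> = ennreal C * (ennreal (A powr q) * ?I)"
        using C by (simp add: ennreal_mult mult.assoc)
      also have "ennreal (A powr q) * ?I = (\<integral>\<^sup>+w. ennreal (cmod (f w) powr q) \<partial>\<Omega>)"
        unfolding fq using disk_measures_simps(4)[OF \<Omega> cont, of "- s"]
        by (subst nn_integral_cmult[symmetric]) (auto simp: ennreal_mult)
      finally show ?thesis
        using Berezin_quotient_eq[OF \<Omega> z, of \<alpha> t p q \<sigma>] s0 by (simp add: s_def)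
    qed
    with mem B1 show ?thesis by blast
  qed
  with C show ?thesis by blast
qed

section \<open>The embedding is dominated by averages over a lattice\<close>

text \<open>Undoes the normalizations in the averaging quotient: area and denominator together are of order
  \<open>(1 - |a|\<^sup>2) powr (2 q / p)\<close>.\<close>

lemma measure_le_averaging_quotient:
  fixes p q r M :: real
  assumes r: "0 < r" "r < 1" and p: "p > 0" and q: "q > 0"
    and \<sigma>: "\<And>z. cmod z < 1 \<Longrightarrow> 0 < \<sigma> (cmod z)" "\<And>z. cmod z < 1 \<Longrightarrow> \<sigma> (cmod z) \<le> M"
    and a: "cmod a < 1" and Q: "averaging_quotient p q \<sigma> r \<Omega> a \<le> Q" "Q \<ge> 0"
  shows "measure \<Omega> (pseudohyperbolic_disk a r) \<le>
    Q * (M powr (q / p) * (2 / (1 - r\<^sup>2))\<^sup>2) * (1 - (cmod a)\<^sup>2) powr (2 * q / p)"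
proof -
  let ?d = "1 - (cmod a)\<^sup>2" and ?E = "pseudohyperbolic_disk a r"
  have d: "?d > 0" using defect_pos[OF a] .
  have area: "measure disk_area ?E > 0"
    using measure_pseudohyperbolic_disk(1)[OF a r] d r
    by (smt (verit) mult_pos_pos zero_less_power divide_pos_pos)
  have X: "\<sigma> (cmod a) powr (q / p) * ?d powr (2 * (q - p) / p) > 0"
    using \<sigma>(1)[OF a] d by simp
  have "measure \<Omega> ?E \<le> Q * (measure disk_area ?E * (\<sigma> (cmod a) powr (q / p) * ?d powr (2 * (q - p) / p)))"
    using Q(1) area X unfolding averaging_quotient_def averaging_def
    by (simp add: pos_divide_le_eq mult.commute mult.left_commute)
  also have "\<dots> \<le> Q * (((2 / (1 - r\<^sup>2))\<^sup>2 * ?d\<^sup>2) * (M powr (q / p) * ?d powr (2 * (q - p) / p)))"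
    using measure_pseudohyperbolic_disk(2)[OF a r] \<sigma>(1,2)[OF a] p q Q(2) area
    by (intro mult_left_mono mult_mono powr_mono2 mult_right_mono) auto
  also have "?d powr (2 * (q - p) / p) = ?d powr (2 * q / p) / ?d\<^sup>2"
    using d p by (simp add: diff_divide_distrib right_diff_distrib powr_diff)
  finally show ?thesis using d by (simp add: ac_simps)
qed

text \<open>The sufficiency of the lattice condition. On each disk of the lattice \<open>|f| powr q\<close> is bounded by a power
  of the local integral \<open>J k\<close> of \<open>|f| powr p\<close>. The factor \<open>J k powr (q / p)\<close> is split into \<open>J k\<close>, which is
  summed using bounded overlap, and \<open>J k powr (q / p - 1)\<close>, which is at most the same power of the
  full integral because \<open>q \<ge> p\<close>.\<close>

lemma Carleson_bound_if_averaging_quotient_bounded_on_lattice: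
  fixes p q m M :: real
  assumes \<sigma>: "0 < m" "\<And>z. cmod z < 1 \<Longrightarrow> m \<le> \<sigma> (cmod z)" "\<And>z. cmod z < 1 \<Longrightarrow> \<sigma> (cmod z) \<le> M"
    and \<sigma>m: "(\<lambda>z. \<sigma> (cmod z)) \<in> borel_measurable (restrict_space borel \<bbbD>)"
    and p: "p > 0" and pq: "p \<le> q" and r: "0 < r" "r < 1" and z: "r_lattice r z"
  shows "\<exists>C>0. \<forall>\<Omega>\<in>disk_measures. \<forall>Q\<ge>0. (\<forall>k. averaging_quotient p q \<sigma> r \<Omega> (z k) \<le> Q) \<longrightarrow>
    (\<forall>f\<in>Bergman_space p \<sigma>. (\<integral>\<^sup>+w. ennreal (cmod (f w) powr q) \<partial>\<Omega>) \<le>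
       ennreal (C * Q) * Bergman_norm p \<sigma> f epowr q)"
proof -
  let ?E = "\<lambda>k. pseudohyperbolic_disk (z k) r" and ?E' = "\<lambda>k. pseudohyperbolic_disk (z k) ((1 + r) / 2)"
  have zD: "cmod (z k) < 1" for k using norm_r_lattice[OF z] .
  have cover: "\<bbbD> = (\<Union>k. ?E k)"
    using z unfolding r_lattice_def by blast
  have q: "q > 0" and \<theta>: "q / p \<ge> 1" using p pq by auto
  have M: "M > 0" using \<sigma>(1) \<sigma>(2,3)[of 0] by simp
  obtain K where K: "K > 0" "\<And>f a w. f holomorphic_on \<bbbD> \<Longrightarrow> a \<in> \<bbbD> \<Longrightarrow> w \<in> pseudohyperbolic_disk a r \<Longrightarrow>
      ennreal (cmod (f w) powr p * (1 - (cmod a)\<^sup>2)\<^sup>2) \<le> ennreal K *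
      (\<integral>\<^sup>+u. ennreal (cmod (f u) powr p) * indicator (pseudohyperbolic_disk a ((1 + r) / 2)) u \<partial>lborel)"
    using norm_powr_le_interior_mean[OF r p] by blast
  obtain N :: nat where N: "\<And>g :: complex \<Rightarrow> ennreal. (\<lambda>u. g u * indicator \<bbbD> u) \<in> borel_measurable borel \<Longrightarrow>
    (\<Sum>k. \<integral>\<^sup>+u. g u * indicator (?E' k) u \<partial>lborel) \<le> of_nat N * (\<integral>\<^sup>+u. g u * indicator \<bbbD> u \<partial>lborel)"
    using r_lattice_sum_le[OF z] by blast
  define L where "L = M powr (q / p) * (2 / (1 - r\<^sup>2))\<^sup>2"
  have "1 - r\<^sup>2 > 0" using r by (simp add: power_less_one_iff)
  then have L: "L > 0" unfolding L_def using M by (intro mult_pos_pos zero_less_power divide_pos_pos) auto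
  \<comment> \<open>The summand \<open>1\<close> keeps the constant positive even if \<open>N\<close> is \<open>0\<close>.\<close>
  define C where "C = L * K powr (q / p) * (real N + 1) * (pi / m) powr (q / p)"
  have C: "C > 0" using L K \<sigma>(1) by (simp add: C_def)
  have "(\<integral>\<^sup>+w. ennreal (cmod (f w) powr q) \<partial>\<Omega>) \<le> ennreal (C * Q) * Bergman_norm p \<sigma> f epowr q"
    if \<Omega>: "\<Omega> \<in> disk_measures" and Q: "Q \<ge> 0" "\<And>k. averaging_quotient p q \<sigma> r \<Omega> (z k) \<le> Q"
      and f: "f \<in> Bergman_space p \<sigma>" for \<Omega> Q f
  proof -
    interpret finite_measure \<Omega> using disk_measures_simps(2)[OF \<Omega>] .
    have hol: "f holomorphic_on \<bbbD>" and fin: "Bergman_norm p \<sigma> f < \<infinity>"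
      using f by (auto simp: Bergman_space_def)
    have fc: "continuous_on \<bbbD> f" using hol by (rule holomorphic_on_imp_continuous_on)
    have fpc: "continuous_on \<bbbD> (\<lambda>w. cmod (f w) powr e)" if "e > 0" for e
      using that by (intro continuous_on_powr' continuous_on_norm fc continuous_on_const) auto
    let ?g = "\<lambda>u. ennreal (cmod (f u) powr p)"
    have gm: "(\<lambda>u. ?g u * indicator \<bbbD> u) \<in> borel_measurable borel"
      using fc p by (intro measurable_norm_powr_indicator) auto
    define I where "I = (\<integral>\<^sup>+u. ?g u * indicator \<bbbD> u \<partial>lborel)"
    define B where "B = (\<integral>\<^sup>+z. ennreal (cmod (f z) powr p * \<sigma> (cmod z)) \<partial>disk_area)"
    have "B < \<infinity>" using fin by (simp add: Bergman_norm_def B_def)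
    then obtain b where b: "B = ennreal b" "b \<ge> 0" by (cases B) auto
    have "ennreal (m / pi) * I = ennreal (1 / pi) * (\<integral>\<^sup>+u. ennreal m * (?g u * indicator \<bbbD> u) \<partial>lborel)"
      unfolding I_def using gm \<sigma>(1)
      by (subst nn_integral_cmult) (auto simp: mult.assoc[symmetric] ennreal_mult[symmetric])
    also have "\<dots> \<le> ennreal (1 / pi) * (\<integral>\<^sup>+u. ennreal (cmod (f u) powr p * \<sigma> (cmod u)) * indicator \<bbbD> u \<partial>lborel)"
    proof (intro mult_left_mono nn_integral_mono)
      fix u :: complex
      show "ennreal m * (?g u * indicator \<bbbD> u) \<le> ennreal (cmod (f u) powr p * \<sigma> (cmod u)) * indicator \<bbbD> u"
      proof (cases "u \<in> \<bbbD>")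
        case True
        then have "m * cmod (f u) powr p \<le> cmod (f u) powr p * \<sigma> (cmod u)"
          using mult_right_mono[OF \<sigma>(2)[of u], of "cmod (f u) powr p"] by (simp add: mult.commute)
        then show ?thesis using True \<sigma>(1) by (simp add: ennreal_leI flip: ennreal_mult)
      qed simp
    qed simp
    also have "\<dots> = B"
      unfolding B_def
      by (intro nn_integral_disk_area[symmetric] measurable_compose[OF _ measurable_ennreal]
          borel_measurable_times \<sigma>m borel_measurable_continuous_on_restrict fpc p)
    finally have IB: "ennreal (m / pi) * I \<le> ennreal b" by (simp add: b)
    have "I \<noteq> \<infinity>"
    proof
      assume "I = \<infinity>"
      then have "ennreal (m / pi) * I = \<infinity>" using \<sigma>(1) by (simp add: ennreal_mult_top)
      then show False using IB by (simp add: top_unique)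
    qed
    then obtain i where i: "I = ennreal i" "i \<ge> 0" by (cases I) auto
    have "m / pi * i \<le> b"
      using IB i \<sigma>(1) b by (simp add: ennreal_le_iff flip: ennreal_mult)
    then have ib: "i \<le> pi / m * b" using \<sigma>(1) by (simp add: field_simps)
    define J where "J k = (\<integral>\<^sup>+u. ?g u * indicator (?E' k) u \<partial>lborel)" for k
    have JI: "J k \<le> I" for k
      unfolding J_def I_def
      by (intro nn_integral_mono) (auto simp: indicator_def pseudohyperbolic_disk_def)
    define j where "j k = enn2real (J k)" for k
    have "J k < \<infinity>" for k using JI[of k] i by (auto intro: le_less_trans)
    then have j: "J k = ennreal (j k)" "j k \<ge> 0" for k by (auto simp: j_def)
    have ji: "j k \<le> i" for k using JI[of k] i j[of k] by (simp add: ennreal_le_iff)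
    have pw: "cmod (f w) powr q \<le> K powr (q / p) * i powr (q / p - 1) * j k / (1 - (cmod (z k))\<^sup>2) powr (2 * q / p)"
      if w: "w \<in> ?E k" for w k
    proof -
      let ?d = "1 - (cmod (z k))\<^sup>2"
      have d: "?d > 0" using defect_pos[OF zD] .
      have "ennreal (cmod (f w) powr p * ?d\<^sup>2) \<le> ennreal K * J k"
        unfolding J_def using zD[of k] by (intro K hol w) auto
      then have "cmod (f w) powr p * ?d\<^sup>2 \<le> K * j k"
        using K j[of k] by (simp add: ennreal_le_iff flip: ennreal_mult)
      then have "(cmod (f w) powr p * ?d\<^sup>2) powr (q / p) \<le> (K * j k) powr (q / p)"
        using p q by (intro powr_mono2) auto
      then have "cmod (f w) powr q * ?d powr (2 * q / p) \<le> K powr (q / p) * j k powr (q / p)"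
        using p d by (simp add: powr_mult powr_powr flip: powr_numeral)
      \<comment> \<open>The exponent \<open>q / p - 1\<close> is nonnegative, so this factor grows with \<open>j k\<close> and can be bounded by the full integral.\<close>
      also have "j k powr (q / p) = j k powr (q / p - 1) * j k"
        using j(2)[of k] by (cases "j k = 0") (auto simp: powr_diff)
      also have "K powr (q / p) * (j k powr (q / p - 1) * j k) \<le> K powr (q / p) * (i powr (q / p - 1) * j k)"
        using j[of k] ji \<theta> by (intro mult_left_mono mult_right_mono powr_mono2) auto
      finally show ?thesis using d by (simp add: pos_le_divide_eq mult.assoc)
    qed
    have meas: "measure \<Omega> (?E k) \<le> Q * L * (1 - (cmod (z k))\<^sup>2) powr (2 * q / p)" for k
      unfolding L_def using \<sigma> less_le_trans[OF \<sigma>(1,2)]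
      by (intro measure_le_averaging_quotient[OF r p q _ _ zD Q(2) Q(1)]) auto
    define T where "T = K powr (q / p) * i powr (q / p - 1) * (Q * L)"
    have T: "T \<ge> 0" using Q L by (simp add: T_def)
    have "(\<integral>\<^sup>+w. ennreal (cmod (f w) powr q) \<partial>\<Omega>) \<le>
        (\<integral>\<^sup>+w. (\<Sum>k. ennreal (cmod (f w) powr q) * indicator (?E k) w) \<partial>\<Omega>)"
    proof (rule nn_integral_mono)
      fix w assume "w \<in> space \<Omega>"
      then have "w \<in> \<bbbD>" using disk_measures_simps(1)[OF \<Omega>] by simp
      then obtain k where k: "w \<in> ?E k" using cover by blast
      have le: "h k \<le> suminf h" for h :: "nat \<Rightarrow> ennreal"
        using sum_le_suminf[of h "{k}"] by (simp add: summableI)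
      show "ennreal (cmod (f w) powr q) \<le> (\<Sum>k. ennreal (cmod (f w) powr q) * indicator (?E k) w)"
        using le[of "\<lambda>k. ennreal (cmod (f w) powr q) * indicator (?E k) w"] k by simp
    qed
    also have "\<dots> = (\<Sum>k. \<integral>\<^sup>+w. ennreal (cmod (f w) powr q) * indicator (?E k) w \<partial>\<Omega>)"
      using pseudohyperbolic_disk_in_sets[OF \<Omega> zD] disk_measures_simps(4)[OF \<Omega> fpc[OF q]]
      by (intro nn_integral_suminf borel_measurable_times_ennreal borel_measurable_indicator) auto
    also have "\<dots> \<le> (\<Sum>k. ennreal T * J k)"
    proof (intro suminf_le summableI)
      fix k
      let ?d = "1 - (cmod (z k))\<^sup>2"
      have d: "?d > 0" using defect_pos[OF zD] .
      let ?S = "K powr (q / p) * i powr (q / p - 1) * j k / ?d powr (2 * q / p)"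
      have S: "?S \<ge> 0" using j[of k] by simp
      have "(\<integral>\<^sup>+w. ennreal (cmod (f w) powr q) * indicator (?E k) w \<partial>\<Omega>) \<le>
          (\<integral>\<^sup>+w. ennreal ?S * indicator (?E k) w \<partial>\<Omega>)"
        using pw by (intro nn_integral_mono) (auto simp: indicator_def intro!: ennreal_leI)
      also have "\<dots> = ennreal ?S * ennreal (measure \<Omega> (?E k))"
        using pseudohyperbolic_disk_in_sets[OF \<Omega> zD]
        by (simp add: nn_integral_cmult_indicator emeasure_eq_measure)
      also have "\<dots> = ennreal (?S * measure \<Omega> (?E k))"
        using S by (intro ennreal_mult[symmetric]) auto
      also have "?S * measure \<Omega> (?E k) \<le> ?S * (Q * L * ?d powr (2 * q / p))"
        using S meas by (intro mult_left_mono)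
      also have "\<dots> = T * j k" using d by (simp add: T_def)
      finally show "(\<integral>\<^sup>+w. ennreal (cmod (f w) powr q) * indicator (?E k) w \<partial>\<Omega>) \<le> ennreal T * J k"
        using T j[of k] by (simp add: ennreal_leI flip: ennreal_mult)
    qed
    also have "\<dots> = ennreal T * (\<Sum>k. J k)" by simp
    also have "\<dots> \<le> ennreal T * (of_nat N * I)"
      unfolding J_def I_def by (intro mult_left_mono N gm) auto
    also have "\<dots> = ennreal (T * (real N * i))"
      using T i by (simp add: ennreal_mult ennreal_of_nat_eq_real_of_nat)
    also have "\<dots> \<le> ennreal (C * Q * b powr (q / p))"
    proof (rule ennreal_leI)
      have "T * (real N * i) = L * K powr (q / p) * real N * Q * (i powr (q / p - 1) * i)"
        by (simp add: T_def)
      also have "i powr (q / p - 1) * i = i powr (q / p)"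
        using i by (cases "i = 0") (auto simp: powr_diff)
      also have "L * K powr (q / p) * real N * Q * i powr (q / p) \<le>
          L * K powr (q / p) * (real N + 1) * Q * (pi / m * b) powr (q / p)"
        using L Q i ib p q by (intro mult_mono powr_mono2 mult_left_mono) auto
      also have "\<dots> = C * Q * b powr (q / p)"
        unfolding C_def powr_mult by (simp add: ac_simps)
      finally show "T * (real N * i) \<le> C * Q * b powr (q / p)" .
    qed
    also have "\<dots> = ennreal (C * Q) * Bergman_norm p \<sigma> f epowr q"
      unfolding Bergman_norm_def B_def[symmetric] b(1) using b C Q
      by (simp add: powr_powr ennreal_mult)
    finally show ?thesis .
  qed
  then show ?thesis using C by blast
qed

section \<open>The embedding norm and the characterizations\<close>

lemma embedding_norm_le:
  assumes q: "q > 0" and C: "\<And>f. f \<in> Bergman_space p \<sigma> \<Longrightarrow>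
      (\<integral>\<^sup>+w. ennreal (cmod (f w) powr q) \<partial>\<Omega>) \<le> C * Bergman_norm p \<sigma> f epowr q"
  shows "embedding_norm p q \<sigma> \<Omega> epowr q \<le> C"
proof -
  have "Lp_norm q \<Omega> f \<le> C epowr (1 / q)"
    if f: "f \<in> Bergman_space p \<sigma>" "Bergman_norm p \<sigma> f \<le> 1" for f
  proof -
    have "Bergman_norm p \<sigma> f epowr q \<le> 1"
      using epowr_mono[OF f(2), of q] q epowr_simps(1)[of 1 q] by simp
    then have "C * Bergman_norm p \<sigma> f epowr q \<le> C * 1"
      by (intro mult_left_mono) auto
    then have "(\<integral>\<^sup>+w. ennreal (cmod (f w) powr q) \<partial>\<Omega>) \<le> C"
      using C[OF f(1)] by simp
    then show ?thesis unfolding Lp_norm_def using q by (intro epowr_mono) auto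
  qed
  then have "embedding_norm p q \<sigma> \<Omega> \<le> C epowr (1 / q)"
    unfolding embedding_norm_def by (intro SUP_least) auto
  then have "embedding_norm p q \<sigma> \<Omega> epowr q \<le> (C epowr (1 / q)) epowr q"
    using q by (intro epowr_mono) auto
  then show ?thesis using q by (simp add: epowr_epowr_inverse)
qed

lemma nn_integral_le_embedding_norm:
  assumes q: "q > 0" and f: "f \<in> Bergman_space p \<sigma>" "Bergman_norm p \<sigma> f \<le> 1"
  shows "(\<integral>\<^sup>+w. ennreal (cmod (f w) powr q) \<partial>\<Omega>) \<le> embedding_norm p q \<sigma> \<Omega> epowr q"
proof -
  have "Lp_norm q \<Omega> f \<le> embedding_norm p q \<sigma> \<Omega>"
    unfolding embedding_norm_def using f by (intro SUP_upper) auto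
  then have "Lp_norm q \<Omega> f epowr q \<le> embedding_norm p q \<sigma> \<Omega> epowr q"
    using q by (intro epowr_mono) auto
  then show ?thesis using q by (simp add: Lp_norm_def epowr_epowr_inverse)
qed

text \<open>Below, \<open>T\<close>, \<open>B\<close>, \<open>A R\<close> and \<open>L r z\<close> are the four quantities to be compared. The inequalities
  \<open>L r z \<le> A r\<close>, \<open>A R \<lesssim> B\<close>, \<open>B \<lesssim> T\<close> and \<open>T \<lesssim> L r z\<close> hold for all radii and lattices separately, so any
  two of the quantities dominate each other as soon as one lattice of a given radius exists. The
  equivalences then say that all four are finite simultaneously.\<close>

theorem theorem1:
  fixes \<sigma> :: "real \<Rightarrow> real" and \<alpha> p q t :: real
  assumes "weight \<sigma>" and "admissible \<sigma>"
    and "\<alpha> > -1"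
    and "0 < p" and "p \<le> q"
    and "t > 2 * q / (p * (\<alpha> + 2))"
  shows "(\<forall>\<Omega>\<in>disk_measures.
      (Bergman_Carleson p q \<sigma> \<Omega> \<longleftrightarrow>
         bounded (Berezin_quotient p q \<sigma> \<alpha> t \<Omega> ` \<bbbD>)) \<and>
      (Bergman_Carleson p q \<sigma> \<Omega> \<longleftrightarrow>
         (\<exists>R\<in>{0<..<1}. bounded (averaging_quotient p q \<sigma> R \<Omega> ` \<bbbD>))) \<and>
      (Bergman_Carleson p q \<sigma> \<Omega> \<longleftrightarrow>
         (\<forall>R\<in>{0<..<1}. bounded (averaging_quotient p q \<sigma> R \<Omega> ` \<bbbD>))) \<and>
      (Bergman_Carleson p q \<sigma> \<Omega> \<longleftrightarrow>
         (\<exists>r\<in>{0<..<1}. \<exists>z. r_lattice r z \<and>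
            bounded (range (\<lambda>k. averaging_quotient p q \<sigma> r \<Omega> (z k))))) \<and>
      (Bergman_Carleson p q \<sigma> \<Omega> \<longleftrightarrow>
         (\<forall>r\<in>{0<..<1}. \<forall>z. r_lattice r z \<longrightarrow>
            bounded (range (\<lambda>k. averaging_quotient p q \<sigma> r \<Omega> (z k))))))
    \<and>
    (\<forall>R\<in>{0<..<1}. \<forall>r\<in>{0<..<1}. \<forall>z. r_lattice r z \<longrightarrow>
      comparable_on disk_measures
        (\<lambda>\<Omega>. embedding_norm p q \<sigma> \<Omega> epowr q)
        (\<lambda>\<Omega>. SUP w\<in>\<bbbD>. ennreal (Berezin_quotient p q \<sigma> \<alpha> t \<Omega> w)) \<and>
      comparable_on disk_measures
        (\<lambda>\<Omega>. SUP w\<in>\<bbbD>. ennreal (Berezin_quotient p q \<sigma> \<alpha> t \<Omega> w))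
        (\<lambda>\<Omega>. SUP w\<in>\<bbbD>. ennreal (averaging_quotient p q \<sigma> R \<Omega> w)) \<and>
      comparable_on disk_measures
        (\<lambda>\<Omega>. SUP w\<in>\<bbbD>. ennreal (averaging_quotient p q \<sigma> R \<Omega> w))
        (\<lambda>\<Omega>. SUP k. ennreal (averaging_quotient p q \<sigma> r \<Omega> (z k))))"
proof -
  note p = \<open>0 < p\<close> and pq = \<open>p \<le> q\<close>
  have q: "q > 0" using p pq by simp
  have s: "(\<alpha> + 2) * t > 2 * q / p"
  proof -
    have "p * (\<alpha> + 2) > 0" using assms(3) p by simp
    then have "2 * q < t * (p * (\<alpha> + 2))" using assms(6) by (simp only: pos_divide_less_eq)
    then show ?thesis using p by (simp only: pos_divide_less_eq ac_simps)
  qed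
  then have s0: "(\<alpha> + 2) * t > 0"
    using p q by (intro less_trans[OF _ s]) simp
  obtain m M where \<sigma>: "0 < m" "\<And>z. cmod z < 1 \<Longrightarrow> m \<le> \<sigma> (cmod z)" "\<And>z. cmod z < 1 \<Longrightarrow> \<sigma> (cmod z) \<le> M"
    and \<sigma>m: "(\<lambda>z. \<sigma> (cmod z)) \<in> borel_measurable (restrict_space borel \<bbbD>)"
    using weight_bounds[OF assms(1)] by blast
  have \<sigma>0: "0 < \<sigma> (cmod z)" if "cmod z < 1" for z
    using \<sigma>(1) \<sigma>(2)[OF that] by simp

  define T where "T \<Omega> = embedding_norm p q \<sigma> \<Omega> epowr q" for \<Omega>
  define B where "B \<Omega> = (SUP w\<in>\<bbbD>. ennreal (Berezin_quotient p q \<sigma> \<alpha> t \<Omega> w))" for \<Omega>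
  define A where "A r \<Omega> = (SUP w\<in>\<bbbD>. ennreal (averaging_quotient p q \<sigma> r \<Omega> w))" for r \<Omega>
  define L where "L r z \<Omega> = (SUP k. ennreal (averaging_quotient p q \<sigma> r \<Omega> (z k)))" for r and z :: "nat \<Rightarrow> complex" and \<Omega>
  note dominated = dominated_on_def[of disk_measures]

  have LA: "dominated_on disk_measures (L r z) (A r)" if z: "r_lattice r z" for r z
    unfolding dominated
  proof (intro exI[of _ 1] conjI ballI)
    fix \<Omega>
    show "L r z \<Omega> \<le> ennreal 1 * A r \<Omega>"
      unfolding L_def A_def using norm_r_lattice[OF z] by (auto intro!: SUP_mono)
  qed simp
  have AB: "dominated_on disk_measures (A R) B" if R: "R \<in> {0<..<1}" for R
  proof -
    obtain C where "C > 0" and C: "\<And>\<Omega> z. \<Omega> \<in> disk_measures \<Longrightarrow> z \<in> \<bbbD> \<Longrightarrow>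
        ennreal (averaging_quotient p q \<sigma> R \<Omega> z) \<le> ennreal C * ennreal (Berezin_quotient p q \<sigma> \<alpha> t \<Omega> z)"
      using averaging_quotient_le_Berezin_quotient[of R \<sigma> p \<alpha> t q] R \<sigma>0 p s0 by force
    have "A R \<Omega> \<le> ennreal C * B \<Omega>" if "\<Omega> \<in> disk_measures" for \<Omega>
      unfolding A_def B_def SUP_mult_left_ennreal
      using C[OF that] by (intro SUP_mono) blast
    with \<open>C > 0\<close> show ?thesis unfolding dominated by blast
  qed
  have BT: "dominated_on disk_measures B T"
  proof -
    obtain C where "C > 0" and C: "\<And>z. z \<in> \<bbbD> \<Longrightarrow> \<exists>f\<in>Bergman_space p \<sigma>. Bergman_norm p \<sigma> f \<le> 1 \<and>
        (\<forall>\<Omega>\<in>disk_measures. ennreal (Berezin_quotient p q \<sigma> \<alpha> t \<Omega> z) \<le>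
           ennreal C * (\<integral>\<^sup>+w. ennreal (cmod (f w) powr q) \<partial>\<Omega>))"
      using Bergman_test_function[OF \<sigma> \<sigma>m p q s] by blast
    have "B \<Omega> \<le> ennreal C * T \<Omega>" if \<Omega>: "\<Omega> \<in> disk_measures" for \<Omega>
      unfolding B_def
    proof (rule SUP_least)
      fix z assume "z \<in> \<bbbD>"
      then obtain f where f: "f \<in> Bergman_space p \<sigma>" "Bergman_norm p \<sigma> f \<le> 1"
        and le: "ennreal (Berezin_quotient p q \<sigma> \<alpha> t \<Omega> z) \<le>
           ennreal C * (\<integral>\<^sup>+w. ennreal (cmod (f w) powr q) \<partial>\<Omega>)"
        using C \<Omega> by blast
      note le
      also have "\<dots> \<le> ennreal C * T \<Omega>"
        unfolding T_def by (intro mult_left_mono nn_integral_le_embedding_norm q f) simp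
      finally show "ennreal (Berezin_quotient p q \<sigma> \<alpha> t \<Omega> z) \<le> ennreal C * T \<Omega>" .
    qed
    with \<open>C > 0\<close> show ?thesis unfolding dominated by blast
  qed
  have Carleson: "\<exists>C>0. \<forall>\<Omega>\<in>disk_measures. L r z \<Omega> < top \<longrightarrow>
      (\<forall>f\<in>Bergman_space p \<sigma>. (\<integral>\<^sup>+w. ennreal (cmod (f w) powr q) \<partial>\<Omega>) \<le>
         ennreal C * L r z \<Omega> * Bergman_norm p \<sigma> f epowr q)"
    if r: "r \<in> {0<..<1}" and z: "r_lattice r z" for r z
  proof -
    obtain C where "C > 0" and C: "\<And>\<Omega> Q f. \<Omega> \<in> disk_measures \<Longrightarrow> Q \<ge> 0 \<Longrightarrow>
        (\<And>k. averaging_quotient p q \<sigma> r \<Omega> (z k) \<le> Q) \<Longrightarrow> f \<in> Bergman_space p \<sigma> \<Longrightarrow>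
        (\<integral>\<^sup>+w. ennreal (cmod (f w) powr q) \<partial>\<Omega>) \<le> ennreal (C * Q) * Bergman_norm p \<sigma> f epowr q"
      using Carleson_bound_if_averaging_quotient_bounded_on_lattice[OF \<sigma> \<sigma>m p pq _ _ z] r
      by (auto simp: Ball_def)
    have "(\<integral>\<^sup>+w. ennreal (cmod (f w) powr q) \<partial>\<Omega>) \<le> ennreal C * L r z \<Omega> * Bergman_norm p \<sigma> f epowr q"
      if \<Omega>: "\<Omega> \<in> disk_measures" and fin: "L r z \<Omega> < top" and f: "f \<in> Bergman_space p \<sigma>" for \<Omega> f
    proof -
      obtain Q where Q: "L r z \<Omega> = ennreal Q" "Q \<ge> 0" using fin by (cases "L r z \<Omega>") auto
      have "ennreal (averaging_quotient p q \<sigma> r \<Omega> (z k)) \<le> ennreal Q" for k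
        unfolding Q(1)[symmetric] L_def by (intro SUP_upper) simp
      then have "averaging_quotient p q \<sigma> r \<Omega> (z k) \<le> Q" for k
        using Q(2) by (simp add: ennreal_le_iff)
      then show ?thesis
        using C[OF \<Omega> Q(2) _ f] Q \<open>C > 0\<close> by (simp add: ennreal_mult)
    qed
    with \<open>C > 0\<close> show ?thesis by blast
  qed
  have TL: "dominated_on disk_measures T (L r z)" if r: "r \<in> {0<..<1}" and z: "r_lattice r z" for r z
  proof -
    obtain C where "C > 0" and C: "\<And>\<Omega> f. \<Omega> \<in> disk_measures \<Longrightarrow> L r z \<Omega> < top \<Longrightarrow> f \<in> Bergman_space p \<sigma> \<Longrightarrow>
        (\<integral>\<^sup>+w. ennreal (cmod (f w) powr q) \<partial>\<Omega>) \<le> ennreal C * L r z \<Omega> * Bergman_norm p \<sigma> f epowr q"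
      using Carleson[OF r z] by blast
    have "T \<Omega> \<le> ennreal C * L r z \<Omega>" if \<Omega>: "\<Omega> \<in> disk_measures" for \<Omega>
    proof (cases "L r z \<Omega> < top")
      case True
      then show ?thesis unfolding T_def by (intro embedding_norm_le q C \<Omega>)
    next
      case False
      then show ?thesis using \<open>C > 0\<close> by (simp add: less_top[symmetric] ennreal_mult_top)
    qed
    with \<open>C > 0\<close> show ?thesis unfolding dominated by blast
  qed

  have TA: "dominated_on disk_measures T (A R)" if R: "R \<in> {0<..<1}" for R
  proof -
    obtain z where z: "r_lattice R z" using ex_r_lattice[of R] R by auto
    show ?thesis using dominated_on_trans[OF TL[OF R z] LA[OF z]] .
  qed
  have AT: "dominated_on disk_measures (A R) T" if "R \<in> {0<..<1}" for R
    using dominated_on_trans[OF AB[OF that] BT] .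
  have LT: "dominated_on disk_measures (L r z) T" if "r \<in> {0<..<1}" "r_lattice r z" for r z
    using dominated_on_trans[OF LA[OF that(2)] AT[OF that(1)]] .
  have TB: "dominated_on disk_measures T B"
    using dominated_on_trans[OF TA AB, of "1/2"] by simp
  have half: "(1/2 :: real) \<in> {0<..<1}" by simp
  obtain z0 where z0: "r_lattice (1/2) z0" using ex_r_lattice[of "1/2"] by auto

  have Carleson_iff: "Bergman_Carleson p q \<sigma> \<Omega> \<longleftrightarrow> T \<Omega> < top" if \<Omega>: "\<Omega> \<in> disk_measures" for \<Omega>
  proof
    assume "Bergman_Carleson p q \<sigma> \<Omega>"
    then obtain C :: real where "\<And>f. f \<in> Bergman_space p \<sigma> \<Longrightarrow>
        (\<integral>\<^sup>+w. ennreal (cmod (f w) powr q) \<partial>\<Omega>) \<le> ennreal C * Bergman_norm p \<sigma> f epowr q"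
      unfolding Bergman_Carleson_def by blast
    then have "T \<Omega> \<le> ennreal C" unfolding T_def by (rule embedding_norm_le[OF q])
    then show "T \<Omega> < top" by (rule le_less_trans) simp
  next
    assume "T \<Omega> < top"
    then have fin: "L (1/2) z0 \<Omega> < top"
      using dominated_on_less_top[OF LT[OF half z0] \<Omega>] by simp
    then obtain Q where Q: "L (1/2) z0 \<Omega> = ennreal Q" "Q \<ge> 0" by (cases "L (1/2) z0 \<Omega>") auto
    obtain C where "C > 0" and C: "\<And>f. f \<in> Bergman_space p \<sigma> \<Longrightarrow>
        (\<integral>\<^sup>+w. ennreal (cmod (f w) powr q) \<partial>\<Omega>) \<le> ennreal C * L (1/2) z0 \<Omega> * Bergman_norm p \<sigma> f epowr q"
      using Carleson[OF half z0] fin \<Omega> by blast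
    \<comment> \<open>The summand \<open>1\<close> keeps the Carleson constant positive for \<open>\<Omega> = 0\<close>.\<close>
    have "ennreal C * L (1/2) z0 \<Omega> \<le> ennreal (C * Q + 1)"
      unfolding Q(1) using \<open>C > 0\<close> Q(2) by (simp add: ennreal_leI flip: ennreal_mult)
    then have "ennreal C * L (1/2) z0 \<Omega> * Bergman_norm p \<sigma> f epowr q \<le>
        ennreal (C * Q + 1) * Bergman_norm p \<sigma> f epowr q" for f
      by (rule mult_right_mono) simp
    then have "\<forall>f\<in>Bergman_space p \<sigma>. (\<integral>\<^sup>+w. ennreal (cmod (f w) powr q) \<partial>\<Omega>) \<le>
        ennreal (C * Q + 1) * Bergman_norm p \<sigma> f epowr q"
      using C order_trans by blast
    moreover have "C * Q + 1 > 0" using \<open>C > 0\<close> Q(2) by (simp add: add_nonneg_pos)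
    ultimately show "Bergman_Carleson p q \<sigma> \<Omega>" unfolding Bergman_Carleson_def by blast
  qed

  have "comparable_on disk_measures T B \<and> comparable_on disk_measures B (A R) \<and>
      comparable_on disk_measures (A R) (L r z)"
    if "R \<in> {0<..<1}" "r \<in> {0<..<1}" "r_lattice r z" for R r z
    using that by (intro conjI comparable_on_if_dominated_on)
      (blast intro: TB BT AB dominated_on_trans[OF BT TA] dominated_on_trans[OF AT TL]
        dominated_on_trans[OF LT TA])+
  moreover
  have "(Bergman_Carleson p q \<sigma> \<Omega> \<longleftrightarrow> bounded (Berezin_quotient p q \<sigma> \<alpha> t \<Omega> ` \<bbbD>)) \<and>
      (\<forall>R\<in>{0<..<1}. Bergman_Carleson p q \<sigma> \<Omega> \<longleftrightarrow> bounded (averaging_quotient p q \<sigma> R \<Omega> ` \<bbbD>)) \<and>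
      (\<forall>r\<in>{0<..<1}. \<forall>z. r_lattice r z \<longrightarrow> (Bergman_Carleson p q \<sigma> \<Omega> \<longleftrightarrow>
         bounded (range (\<lambda>k. averaging_quotient p q \<sigma> r \<Omega> (z k)))))"
    if \<Omega>: "\<Omega> \<in> disk_measures" for \<Omega>
    unfolding Carleson_iff[OF \<Omega>]
      bounded_image_iff_SUP_less_top[OF Berezin_quotient_nonneg]
      bounded_image_iff_SUP_less_top[OF averaging_quotient_nonneg]
      B_def[symmetric] A_def[symmetric] L_def[symmetric]
    using dominated_on_less_top[OF _ \<Omega>] TB BT TA AT TL LT by blast
  ultimately show ?thesis
    unfolding T_def B_def A_def L_def using half z0 by (intro conjI ballI allI impI) blast+
qed

end
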